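(* Let $\mathcal{O}_a$ be an open subset of $\mathbb{R}^m$ and $\tau_a^*:\mathcal{O}_a\to\mathbb{R}^m$ a diffeomorphism onto its image. Suppose that (a) either $\tau_a^*(\mathcal{O}_a)$ verifies condition $\mathbb{B}$ (see context), (b) or $\mathcal{O}_a$ is $C^2$-diffeomorphic to $\mathbb{R}^m$ and $\tau_a^*$ is $C^2$. Then for any compact set $K$ in $\mathcal{O}_a$, there exists a diffeomorphism $\tau_e^*:\mathcal{O}_a\to\mathbb{R}^m$ such that $$\tau_e^*(\mathcal{O}_a)=\mathbb{R}^m\qquad\text{and}\qquad \tau_e^*(z)=\tau_a^*(z)\quad\forall z\in K.$$
   Context: Diffeomorphisms are $C^1$ diffeomorphisms unless a higher class is specified. Condition $\mathbb{B}$: an open subset $E$ of $\mathbb{R}^m$ verifies condition $\mathbb{B}$ if there exist a $C^1$ function $\kappa:\mathbb{R}^m\to\mathbb{R}$, a bounded $C^1$ vector field $\chi$ on $\mathbb{R}^m$, and a closed set $K_0$ contained in $E$ such that: 1. $E=\{z\in\mathbb{R}^m:\kappa(z)<0\}$; 2. $K_0$ is globally attractive for $\chi$, i.e. for every $z\in\mathbb{R}^m$ and every open neighborhood $U$ of $K_0$, the solution of $\dot z=\chi(z)$ starting from $z$ belongs to $U$ for all sufficiently large times; 3. (transversality) $\frac{\partial\kappa}{\partial z}(z)\,\chi(z)<0$ for all $z\in\mathbb{R}^m$ with $\kappa(z)=0$. *)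

theory Defs
  imports "HOL-Analysis.Analysis"
begin

text \<open>Differentiability classes of maps between normed spaces. They are meant for open \<open>U\<close>:
  the derivative is the full one, and its continuity is in the operator norm.\<close>

definition C1_on ::
    "'a::real_normed_vector set \<Rightarrow> ('a \<Rightarrow> 'b::real_normed_vector) \<Rightarrow> bool" where
  "C1_on U f \<longleftrightarrow>
    (\<exists>f' :: 'a \<Rightarrow> 'a \<Rightarrow>\<^sub>L 'b.
      (\<forall>x\<in>U. (f has_derivative blinfun_apply (f' x)) (at x)) \<and> continuous_on U f')"

definition C2_on ::
    "'a::real_normed_vector set \<Rightarrow> ('a \<Rightarrow> 'b::real_normed_vector) \<Rightarrow> bool" where
  "C2_on U f \<longleftrightarrow>
    (\<exists>f' :: 'a \<Rightarrow> 'a \<Rightarrow>\<^sub>L 'b.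
      (\<forall>x\<in>U. (f has_derivative blinfun_apply (f' x)) (at x)) \<and> C1_on U f')"

definition C1_diffeomorphism ::
    "'a::real_normed_vector set \<Rightarrow> 'b::real_normed_vector set \<Rightarrow> ('a \<Rightarrow> 'b) \<Rightarrow> bool" where
  "C1_diffeomorphism U V f \<longleftrightarrow>
    open U \<and> open V \<and> bij_betw f U V \<and> C1_on U f \<and> C1_on V (inv_into U f)"

definition C2_diffeomorphism ::
    "'a::real_normed_vector set \<Rightarrow> 'b::real_normed_vector set \<Rightarrow> ('a \<Rightarrow> 'b) \<Rightarrow> bool" where
  "C2_diffeomorphism U V f \<longleftrightarrow>
    open U \<and> open V \<and> bij_betw f U V \<and> C2_on U f \<and> C2_on V (inv_into U f)"

definition ode_solution_from ::
    "('a::real_normed_vector \<Rightarrow> 'a) \<Rightarrow> 'a \<Rightarrow> (real \<Rightarrow> 'a) \<Rightarrow> bool" where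
  "ode_solution_from X z x \<longleftrightarrow>
    x 0 = z \<and> (\<forall>t\<ge>0. (x has_vector_derivative X (x t)) (at t within {0..}))"

text \<open>For a bounded \<open>C\<^sup>1\<close> field the forward solution from each point exists on \<open>[0, \<infinity>)\<close> and is
  unique there, so quantifying over all solutions amounts to speaking of the solution.\<close>

definition globally_attractive ::
    "('a::real_normed_vector \<Rightarrow> 'a) \<Rightarrow> 'a set \<Rightarrow> bool" where
  "globally_attractive X K\<^sub>0 \<longleftrightarrow>
    (\<forall>z U x. open U \<longrightarrow> K\<^sub>0 \<subseteq> U \<longrightarrow> ode_solution_from X z x \<longrightarrow>
      (\<forall>\<^sub>F t in at_top. x t \<in> U))"

definition condition_B :: "'a::euclidean_space set \<Rightarrow> bool" where
  "condition_B E \<longleftrightarrow>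
    (\<exists>(\<kappa> :: 'a \<Rightarrow> real) (X :: 'a \<Rightarrow> 'a) K\<^sub>0.
      C1_on UNIV \<kappa> \<and>
      C1_on UNIV X \<and> bounded (range X) \<and>
      closed K\<^sub>0 \<and> K\<^sub>0 \<subseteq> E \<and>
      E = {z. \<kappa> z < 0} \<and>
      globally_attractive X K\<^sub>0 \<and>
      (\<forall>z. \<kappa> z = 0 \<longrightarrow> frechet_derivative \<kappa> (at z) (X z) < 0))"

end

theory Submission
  imports Defs "HOL-Complex_Analysis.Great_Picard"
begin

text \<open>Flows are replaced throughout by finite compositions of Euler steps \<open>x \<mapsto> x + h Y(x)\<close>: for a
  compactly supported \<open>C\<^sup>1\<close> field \<open>Y\<close> and small \<open>h\<close> these are \<open>C\<^sup>1\<close> diffeomorphisms of the whole space,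
  being Lipschitz-small perturbations of the identity, so no smooth dependence of solutions on
  initial values is needed.

  In case (b), \<open>f = \<tau>\<^sub>a \<circ> \<phi>\<inverse>\<close> embeds \<open>\<real>\<^sup>m\<close>. Near the origin \<open>f\<close> agrees with a diffeomorphism \<open>F\<close> of
  \<open>\<real>\<^sup>m\<close>. If \<open>\<sigma>\<close> is a compactly supported diffeomorphism shrinking a large ball into the region
  where \<open>F = f\<close>, then \<open>f \<circ> \<sigma> \<circ> f\<inverse>\<close>, continued by the identity, is a diffeomorphism \<open>\<Theta>\<close> of \<open>\<real>\<^sup>m\<close>, and
  \<open>\<Theta>\<inverse> \<circ> F \<circ> \<sigma>\<close> agrees with \<open>f\<close> on the large ball.

  In case (a), let \<open>E = \<tau>\<^sub>a(O\<^sub>a)\<close>. Given compact sets \<open>L \<subseteq> E\<close> and \<open>B\<close>, the Euler steps of \<open>\<chi>\<close>, cut off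
  near \<open>L\<close> and far away, move \<open>B\<close> into \<open>E\<close>: otherwise Euler polygons avoiding \<open>E\<close> would converge to a
  solution avoiding \<open>E\<close>, and transversality prevents leaving \<open>E\<close> again. The inverse of the
  composition is a diffeomorphism \<open>g\<close> of \<open>\<real>\<^sup>m\<close> that fixes \<open>L\<close> and satisfies \<open>B \<subseteq> g(E)\<close>. Composing
  such \<open>g\<close> for exhausting sequences of \<open>L\<close> and \<open>B\<close> stabilises locally on \<open>E\<close> to a diffeomorphism
  from \<open>E\<close> onto \<open>\<real>\<^sup>m\<close>.\<close>

subsection \<open>Maps of class \<open>C\<^sup>1\<close> and diffeomorphisms\<close>

lemma C1_onE:
  assumes "C1_on U f"
  obtains f' where "\<And>x. x \<in> U \<Longrightarrow> (f has_derivative blinfun_apply (f' x)) (at x)"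
    "continuous_on U f'"
  using assms unfolding C1_on_def by blast

lemma C1_onI:
  assumes "\<And>x. x \<in> U \<Longrightarrow> (f has_derivative blinfun_apply (f' x)) (at x)"
    "continuous_on U f'"
  shows "C1_on U f"
  using assms unfolding C1_on_def by blast

lemma C2_on_imp_C1_on:
  assumes "C2_on U f"
  shows "C1_on U f"
proof -
  obtain f' where f': "\<And>x. x \<in> U \<Longrightarrow> (f has_derivative blinfun_apply (f' x)) (at x)" "C1_on U f'"
    using assms unfolding C2_on_def by blast
  then have "continuous_on U f'"
    by (metis C1_onE continuous_at_imp_continuous_on has_derivative_continuous)
  with f' show ?thesis
    by (blast intro: C1_onI)
qed

lemma C1_on_imp_continuous_on: "C1_on U f \<Longrightarrow> continuous_on U f"
  by (metis C1_onE continuous_at_imp_continuous_on has_derivative_continuous)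

lemma C1_on_subset: "C1_on U f \<Longrightarrow> V \<subseteq> U \<Longrightarrow> C1_on V f"
  unfolding C1_on_def by (meson continuous_on_subset subset_iff)

lemma C1_on_const: "C1_on U (\<lambda>x. c)"
  by (rule C1_onI[where f'="\<lambda>x. 0"]) (auto simp: zero_blinfun.rep_eq)

lemma C1_on_linear: "bounded_linear f \<Longrightarrow> C1_on U f"
  by (rule C1_onI[where f'="\<lambda>x. Blinfun f"])
     (auto simp: bounded_linear_Blinfun_apply bounded_linear_imp_has_derivative)

lemma C1_on_id: "C1_on U (\<lambda>x. x)"
  by (simp add: C1_on_linear bounded_linear_ident)

lemma C1_on_add:
  assumes "C1_on U f" "C1_on U g"
  shows "C1_on U (\<lambda>x. f x + g x)"
proof -
  obtain f' where f: "\<And>x. x \<in> U \<Longrightarrow> (f has_derivative blinfun_apply (f' x)) (at x)"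
    "continuous_on U f'" using assms(1) C1_onE by blast
  obtain g' where g: "\<And>x. x \<in> U \<Longrightarrow> (g has_derivative blinfun_apply (g' x)) (at x)"
    "continuous_on U g'" using assms(2) C1_onE by blast
  show ?thesis
    by (rule C1_onI[where f'="\<lambda>x. f' x + g' x"])
       (auto intro!: derivative_eq_intros continuous_intros f g simp: blinfun.bilinear_simps)
qed

lemma C1_on_scaleR:
  fixes f :: "'a::real_normed_vector \<Rightarrow> real" and g :: "'a \<Rightarrow> 'b::real_normed_vector"
  assumes "C1_on U f" "C1_on U g"
  shows "C1_on U (\<lambda>x. f x *\<^sub>R g x)"
proof -
  obtain f' where f: "\<And>x. x \<in> U \<Longrightarrow> (f has_derivative blinfun_apply (f' x)) (at x)"
    "continuous_on U f'" using assms(1) C1_onE by blast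
  obtain g' where g: "\<And>x. x \<in> U \<Longrightarrow> (g has_derivative blinfun_apply (g' x)) (at x)"
    "continuous_on U g'" using assms(2) C1_onE by blast
  note [continuous_intros] = C1_on_imp_continuous_on[OF assms(1)] C1_on_imp_continuous_on[OF assms(2)]
  show ?thesis
  proof (rule C1_onI)
    fix x assume x: "x \<in> U"
    show "((\<lambda>x. f x *\<^sub>R g x) has_derivative
        blinfun_apply (f x *\<^sub>R g' x + (blinfun_scaleR_left (g x) o\<^sub>L f' x))) (at x)"
      by (rule derivative_eq_intros f g x)+ (auto simp: blinfun.bilinear_simps)
  next
    show "continuous_on U (\<lambda>x. f x *\<^sub>R g' x + (blinfun_scaleR_left (g x) o\<^sub>L f' x))"
      by (intro continuous_intros f g)
  qed
qed

lemma C1_on_compose: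
  assumes "C1_on U f" "C1_on V g" "f ` U \<subseteq> V"
  shows "C1_on U (\<lambda>x. g (f x))"
proof -
  obtain f' where f: "\<And>x. x \<in> U \<Longrightarrow> (f has_derivative blinfun_apply (f' x)) (at x)"
    "continuous_on U f'" using assms(1) C1_onE by blast
  obtain g' where g: "\<And>x. x \<in> V \<Longrightarrow> (g has_derivative blinfun_apply (g' x)) (at x)"
    "continuous_on V g'" using assms(2) C1_onE by blast
  show ?thesis
  proof (rule C1_onI)
    fix x assume x: "x \<in> U"
    with assms(3) have "f x \<in> V" by auto
    from diff_chain_at[OF f(1)[OF x] g(1)[OF this]]
    show "((\<lambda>x. g (f x)) has_derivative blinfun_apply (g' (f x) o\<^sub>L f' x)) (at x)"
      by (simp add: o_def blinfun_compose.rep_eq)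
  next
    have "continuous_on U (\<lambda>x. g' (f x))"
      using continuous_on_compose2[OF g(2) C1_on_imp_continuous_on[OF assms(1)] assms(3)] .
    then show "continuous_on U (\<lambda>x. g' (f x) o\<^sub>L f' x)"
      by (intro continuous_intros f)
  qed
qed

lemma C1_on_locally:
  assumes "\<And>x. x \<in> U \<Longrightarrow> \<exists>S. open S \<and> x \<in> S \<and> C1_on S f"
  shows "C1_on U f"
proof -
  \<comment> \<open>The local derivative maps are chosen independently, so one candidate is fixed
    for all points. By uniqueness of derivatives it coincides with the local one on each
    \<open>S\<close> and inherits its continuity.\<close>
  define F where "F = (\<lambda>x. Blinfun (frechet_derivative f (at x)))"
  have F: "F x = D" if "(f has_derivative blinfun_apply D) (at x)" for D x
    unfolding F_def using frechet_derivative_at[OF that] by (metis blinfun_apply_inverse)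
  have *: "(f has_derivative blinfun_apply (F x)) (at x) \<and> isCont F x" if "x \<in> U" for x
  proof -
    obtain S where S: "open S" "x \<in> S" "C1_on S f" using assms \<open>x \<in> U\<close> by blast
    then obtain f' where f: "\<And>x. x \<in> S \<Longrightarrow> (f has_derivative blinfun_apply (f' x)) (at x)"
      "continuous_on S f'" using C1_onE by blast
    have "continuous_on S F"
      using continuous_on_cong[of S S F f'] f F by auto
    then show ?thesis
      using S(1,2) F f(1) by (metis continuous_on_eq_continuous_at)
  qed
  then show ?thesis
    by (intro C1_onI[where f'=F]) (auto simp: continuous_at_imp_continuous_on)
qed

lemma C1_on_cong:
  assumes "C1_on U f" "open U" "\<And>x. x \<in> U \<Longrightarrow> g x = f x"
  shows "C1_on U g"
proof -
  obtain f' where f: "\<And>x. x \<in> U \<Longrightarrow> (f has_derivative blinfun_apply (f' x)) (at x)"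
    "continuous_on U f'" using assms(1) C1_onE by blast
  show ?thesis
    by (rule C1_onI[OF _ f(2)]) (metis assms(2,3) f(1) has_derivative_transform_within_open)
qed

text \<open>\<open>inv_into\<close> agrees with \<open>g\<close> on the open set \<open>V\<close>
  and so inherits its class; an explicit inverse thus replaces the choice function.\<close>

lemma C1_diffeomorphismI:
  assumes "open U" "open V" "C1_on U f" "C1_on V g"
    and "\<And>x. x \<in> U \<Longrightarrow> f x \<in> V \<and> g (f x) = x"
    and "\<And>y. y \<in> V \<Longrightarrow> g y \<in> U \<and> f (g y) = y"
  shows "C1_diffeomorphism U V f"
proof -
  have b: "bij_betw f U V"
    by (rule bij_betw_byWitness[where f'=g]) (use assms in auto)
  have "inv_into U f y = g y" if "y \<in> V" for y
    using assms(5,6) that b by (metis bij_betw_def inv_into_f_f)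
  then show ?thesis
    unfolding C1_diffeomorphism_def using assms b C1_on_cong by blast
qed

lemma C1_diffeomorphism_inv:
  assumes "C1_diffeomorphism U V f"
  shows "C1_diffeomorphism V U (inv_into U f)"
proof (rule C1_diffeomorphismI[where g=f])
  have b: "bij_betw f U V" using assms by (simp add: C1_diffeomorphism_def)
  show "inv_into U f x \<in> U \<and> f (inv_into U f x) = x" if "x \<in> V" for x
    using b that by (simp add: bij_betw_def f_inv_into_f inv_into_into)
  show "f x \<in> V \<and> inv_into U f (f x) = x" if "x \<in> U" for x
    using b that by (auto simp: bij_betw_def)
qed (use assms in \<open>auto simp: C1_diffeomorphism_def\<close>)

lemma C1_diffeomorphism_compose:
  assumes "C1_diffeomorphism U V f" "C1_diffeomorphism V W g"
  shows "C1_diffeomorphism U W (\<lambda>x. g (f x))"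
proof (rule C1_diffeomorphismI[where g="\<lambda>y. inv_into U f (inv_into V g y)"])
  have b: "bij_betw f U V" "bij_betw g V W" using assms by (auto simp: C1_diffeomorphism_def)
  show "g (f x) \<in> W \<and> inv_into U f (inv_into V g (g (f x))) = x" if "x \<in> U" for x
    using b that by (auto simp: bij_betw_def)
  show "inv_into U f (inv_into V g y) \<in> U \<and> g (f (inv_into U f (inv_into V g y))) = y"
    if "y \<in> W" for y
    using b that by (auto simp: bij_betw_def f_inv_into_f inv_into_into)
  show "C1_on U (\<lambda>x. g (f x))"
    by (rule C1_on_compose[where V=V])
       (use assms b in \<open>auto simp: C1_diffeomorphism_def bij_betw_def\<close>)
  show "C1_on W (\<lambda>y. inv_into U f (inv_into V g y))"
    by (rule C1_on_compose[where V=V])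
       (use assms b in \<open>auto simp: C1_diffeomorphism_def bij_betw_def inv_into_into\<close>)
qed (use assms in \<open>auto simp: C1_diffeomorphism_def\<close>)

lemma C1_diffeomorphism_id: "open U \<Longrightarrow> C1_diffeomorphism U U (\<lambda>x. x)"
  by (rule C1_diffeomorphismI[where g="\<lambda>x. x"]) (auto simp: C1_on_id)

lemma C1_diffeomorphism_funpow:
  fixes f :: "'a::real_normed_vector \<Rightarrow> 'a"
  shows "C1_diffeomorphism UNIV UNIV f \<Longrightarrow> C1_diffeomorphism UNIV UNIV (f ^^ n)"
proof (induction n)
  case 0
  have "f ^^ 0 = (\<lambda>x. x)" by (simp add: fun_eq_iff)
  then show ?case by (metis C1_diffeomorphism_id open_UNIV)
next
  case (Suc n)
  then show ?case
    using C1_diffeomorphism_compose[of UNIV UNIV "f ^^ n" UNIV f] by (simp add: o_def)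
qed

lemma C2_diffeomorphism_imp_C1: "C2_diffeomorphism U V f \<Longrightarrow> C1_diffeomorphism U V f"
  by (simp add: C2_diffeomorphism_def C1_diffeomorphism_def C2_on_imp_C1_on)

section \<open>Injective C^1 maps with invertible derivative\<close>

lemma continuous_on_blinfun_inverse:
  fixes A :: "'c::topological_space \<Rightarrow> 'a::real_normed_vector \<Rightarrow>\<^sub>L 'b::real_normed_vector"
  assumes A: "continuous_on S A"
    and BA: "\<And>x. x \<in> S \<Longrightarrow> B x o\<^sub>L A x = id_blinfun"
    and AB: "\<And>x. x \<in> S \<Longrightarrow> A x o\<^sub>L B x = id_blinfun"
  shows "continuous_on S B"
proof -
  \<comment> \<open>The identity B y - B x = B y (A x - A y) B x is behind the continuity of
    operator inversion.\<close>
  have est: "norm (B y - B x) \<le> norm (B y) * norm (A x - A y) * norm (B x)"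
    if "x \<in> S" "y \<in> S" for x y
  proof -
    have "B y - B x = (B y o\<^sub>L (A x - A y)) o\<^sub>L B x"
    proof (rule blinfun_eqI)
      fix i
      have "B y (A y j) = j" for j
        using BA[OF that(2)] by (metis blinfun_apply_blinfun_compose blinfun_apply_id_blinfun)
      moreover have "A x (B x j) = j" for j
        using AB[OF that(1)] by (metis blinfun_apply_blinfun_compose blinfun_apply_id_blinfun)
      ultimately show "blinfun_apply (B y - B x) i = blinfun_apply ((B y o\<^sub>L (A x - A y)) o\<^sub>L B x) i"
        by (simp add: blinfun.bilinear_simps)
    qed
    then show ?thesis
      by (metis (no_types, lifting) mult_right_mono norm_blinfun_compose norm_ge_zero order_trans)
  qed
  have "(B \<longlongrightarrow> B x) (at x within S)" if x: "x \<in> S" for x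
  proof -
    have "((\<lambda>y. norm (A x - A y) * norm (B x)) \<longlongrightarrow> norm (A x - A x) * norm (B x)) (at x within S)"
      using A x by (intro tendsto_intros) (simp add: continuous_on_def)
    then have lim: "((\<lambda>y. norm (A x - A y) * norm (B x)) \<longlongrightarrow> 0) (at x within S)"
      by simp
    then have "\<forall>\<^sub>F y in at x within S. norm (A x - A y) * norm (B x) < 1/2"
      by (rule order_tendstoD) simp
    moreover have "\<forall>\<^sub>F y in at x within S. y \<in> S"
      by (simp add: eventually_at_filter)
    ultimately have "\<forall>\<^sub>F y in at x within S.
        norm (B y - B x) \<le> 2 * norm (B x) * (norm (A x - A y) * norm (B x))"
    proof eventually_elim
      case (elim y)
      have e: "norm (B y - B x) \<le> norm (B y) * (norm (A x - A y) * norm (B x))"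
        using est[OF x elim(2)] by (simp add: mult.assoc)
      also have "\<dots> \<le> norm (B y) * (1/2)"
        using elim(1) by (intro mult_left_mono) auto
      \<comment> \<open>Half of \<open>norm (B y)\<close> is absorbed on the left. With this bound
        the estimate depends on \<open>y\<close> only through \<open>A y\<close>.\<close>
      finally have "norm (B y) \<le> 2 * norm (B x)"
        using norm_triangle_ineq2[of "B y" "B x"] by linarith
      then have "norm (B y) * (norm (A x - A y) * norm (B x))
          \<le> 2 * norm (B x) * (norm (A x - A y) * norm (B x))"
        by (intro mult_right_mono) auto
      with e show ?case by linarith
    qed
    moreover have "((\<lambda>y. 2 * norm (B x) * (norm (A x - A y) * norm (B x))) \<longlongrightarrow> 0) (at x within S)"
      using tendsto_mult_right_zero[OF lim] by simp
    ultimately have "((\<lambda>y. B y - B x) \<longlongrightarrow> 0) (at x within S)"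
      by (rule Lim_null_comparison)
    then show ?thesis
      by (simp add: LIM_zero_iff)
  qed
  then show ?thesis
    by (simp add: continuous_on_def)
qed

text \<open>Invariance of domain makes the image open and the inverse continuous. A continuous
  inverse is differentiable where the derivative of \<open>f\<close> is invertible, and continuity
  of operator inversion then gives class C^1.\<close>

lemma C1_diffeomorphism_of_inj_on:
  fixes f :: "'a::euclidean_space \<Rightarrow> 'a"
  assumes U: "open U" and inj: "inj_on f U"
    and f: "\<And>x. x \<in> U \<Longrightarrow> (f has_derivative blinfun_apply (f' x)) (at x)" "continuous_on U f'"
    and inj': "\<And>x. x \<in> U \<Longrightarrow> inj (blinfun_apply (f' x))"
  shows "C1_diffeomorphism U (f ` U) f"
proof -
  have cf: "continuous_on U f"
    using f(1) by (meson continuous_at_imp_continuous_on has_derivative_continuous)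
  have op: "open (f ` U)"
    using invariance_of_domain[OF cf U inj] .
  define g where "g = inv_into U f"
  have gf: "g (f x) = x" if "x \<in> U" for x
    using inj that by (simp add: g_def)
  obtain h where h: "homeomorphism U (f ` U) f h"
    using invariance_of_domain_homeomorphism[OF U cf _ inj] by auto
  then have "h y = g y" if "y \<in> f ` U" for y
    using that gf by (auto simp: homeomorphism_def)
  then have cg: "continuous_on (f ` U) g"
    using h by (metis continuous_on_cong homeomorphism_def)
  define B where "B = (\<lambda>x. Blinfun (inv (blinfun_apply (f' x))))"
  have B: "B x o\<^sub>L f' x = id_blinfun \<and> f' x o\<^sub>L B x = id_blinfun" if "x \<in> U" for x
  proof -
    have l: "linear (blinfun_apply (f' x))"
      using blinfun.bounded_linear_right bounded_linear.linear by blast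
    \<comment> \<open>In finite dimension an injective endomorphism is bijective, and its inverse is
      bounded.\<close>
    have bij: "bij (blinfun_apply (f' x))"
      using inj'[OF that] linear_injective_imp_surjective[OF l] by (simp add: bij_def)
    have "bounded_linear (inv (blinfun_apply (f' x)))"
      using inj_linear_imp_inv_linear[OF l inj'[OF that]] linear_conv_bounded_linear by blast
    then have "blinfun_apply (B x) = inv (blinfun_apply (f' x))"
      by (simp add: B_def bounded_linear_Blinfun_apply)
    then show ?thesis
      using bij by (auto intro!: blinfun_eqI simp: bij_is_inj bij_is_surj surj_f_inv_f)
  qed
  have cB: "continuous_on U B"
    using continuous_on_blinfun_inverse[OF f(2)] B by blast
  have "C1_on (f ` U) g"
  proof (rule C1_onI)
    fix y assume "y \<in> f ` U"
    then obtain x where x: "x \<in> U" "y = f x" by auto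
    have "(g has_derivative blinfun_apply (B x)) (at (f x))"
      by (rule has_derivative_inverse_dieudonne[OF U op cf cg gf x(1) f(1)[OF x(1)]])
         (use B[OF x(1)] in \<open>auto simp: blinfun.bounded_linear_right blinfun_compose.rep_eq fun_eq_iff
             dest!: arg_cong[where f=blinfun_apply]\<close>)
    then show "(g has_derivative blinfun_apply (B (g y))) (at y)"
      using x gf by simp
  next
    show "continuous_on (f ` U) (\<lambda>y. B (g y))"
      by (rule continuous_on_compose2[OF cB cg]) (use gf in auto)
  qed
  then show ?thesis
    unfolding C1_diffeomorphism_def g_def[symmetric]
    using U op inj f C1_onI by (auto simp: bij_betw_def)
qed

subsection \<open>Cutoff functions and Euler steps\<close>

lemma C1_on_real_derivative:
  fixes f :: "real \<Rightarrow> real"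
  assumes "\<And>x. (f has_real_derivative f' x) (at x)" "continuous_on UNIV f'"
  shows "C1_on UNIV f"
proof (rule C1_onI)
  show "(f has_derivative blinfun_apply (f' x *\<^sub>R id_blinfun)) (at x)" for x
    using assms(1)[of x] unfolding has_field_derivative_def
    by (simp add: scaleR_blinfun.rep_eq id_blinfun.rep_eq)
  show "continuous_on UNIV (\<lambda>x. f' x *\<^sub>R (id_blinfun :: real \<Rightarrow>\<^sub>L real))"
    by (intro continuous_intros assms)
qed

text \<open>The usual quotient p(t) / (p(t) + p(1 - t)), with p(t) = max(0, t)^2 in place of
  exp(-1/t). This p is C^1, and the denominator never vanishes because t and 1 - t are not both
  nonpositive.\<close>

definition smoothstep :: "real \<Rightarrow> real" where
  "smoothstep t = (max 0 t)\<^sup>2 / ((max 0 t)\<^sup>2 + (max 0 (1 - t))\<^sup>2)"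

lemma smoothstep_pos: "(max 0 t)\<^sup>2 + (max 0 (1 - t))\<^sup>2 > (0::real)"
  by (cases "t > 0") (auto intro: add_pos_nonneg add_nonneg_pos)

lemma smoothstep_eq_0: "t \<le> 0 \<Longrightarrow> smoothstep t = 0"
  by (simp add: smoothstep_def)

lemma smoothstep_eq_1: "t \<ge> 1 \<Longrightarrow> smoothstep t = 1"
  by (simp add: smoothstep_def)

lemma smoothstep_bounds: "0 \<le> smoothstep t" "smoothstep t \<le> 1"
  using smoothstep_pos[of t] by (auto simp: smoothstep_def divide_le_eq)

lemma has_real_derivative_max_0_squared:
  "((\<lambda>t::real. (max 0 t)\<^sup>2) has_real_derivative 2 * max 0 t) (at t)"
proof -
  consider "t < 0" | "t = 0" | "t > 0" by linarith
  then show ?thesis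
  proof cases
    case 1
    have "((\<lambda>t::real. 0) has_real_derivative 2 * max 0 t) (at t)"
      using 1 by simp
    then show ?thesis
      by (rule has_field_derivative_transform_within_open[where S="{..<0}"]) (use 1 in auto)
  next
    case 2
    \<comment> \<open>At the corner of the maximum the difference quotient is bounded by
      |h|.\<close>
    have "((\<lambda>h. (max 0 h)\<^sup>2 / h) \<longlongrightarrow> 0) (at (0::real))"
    proof (rule Lim_null_comparison[where g="\<lambda>h. \<bar>h\<bar>"])
      show "\<forall>\<^sub>F h in at (0::real). norm ((max 0 h)\<^sup>2 / h) \<le> \<bar>h\<bar>"
        by (rule always_eventually) (auto simp: max_def power2_eq_square)
      show "((\<lambda>h. \<bar>h\<bar>) \<longlongrightarrow> 0) (at (0::real))"
        using tendsto_rabs_zero[OF tendsto_ident_at[of 0 UNIV]] by simp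
    qed
    then show ?thesis
      using 2 by (simp add: DERIV_def)
  next
    case 3
    have "((\<lambda>t::real. t\<^sup>2) has_real_derivative 2 * max 0 t) (at t)"
      using 3 by (auto intro!: derivative_eq_intros)
    then show ?thesis
      by (rule has_field_derivative_transform_within_open[where S="{0<..}"]) (use 3 in auto)
  qed
qed

lemma C1_on_smoothstep: "C1_on UNIV smoothstep"
proof -
  have p: "(max 0 t)\<^sup>2 + (max 0 (1 - t))\<^sup>2 \<noteq> 0" for t :: real
    using smoothstep_pos[of t] by linarith
  have d: "((\<lambda>t::real. (max 0 (1 - t))\<^sup>2) has_real_derivative 2 * max 0 (1 - t) * - 1) (at t)" for t
    by (rule DERIV_chain2[OF has_real_derivative_max_0_squared]) (auto intro!: derivative_eq_intros)
  let ?D = "\<lambda>t::real. (2 * max 0 t * ((max 0 t)\<^sup>2 + (max 0 (1 - t))\<^sup>2)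
      - (max 0 t)\<^sup>2 * (2 * max 0 t + 2 * max 0 (1 - t) * - 1))
      / (((max 0 t)\<^sup>2 + (max 0 (1 - t))\<^sup>2) * ((max 0 t)\<^sup>2 + (max 0 (1 - t))\<^sup>2))"
  have "(smoothstep has_real_derivative ?D t) (at t)" for t
    unfolding smoothstep_def[abs_def]
    by (rule DERIV_divide DERIV_add has_real_derivative_max_0_squared d p)+
  moreover have "continuous_on UNIV ?D"
    by (intro continuous_intros) (use p in auto)
  ultimately show ?thesis
    by (rule C1_on_real_derivative)
qed

lemma C1_on_norm_squared: "C1_on UNIV (\<lambda>x::'a::real_inner. (norm x)\<^sup>2)"
proof (rule C1_onI)
  show "((\<lambda>x::'a. (norm x)\<^sup>2) has_derivative blinfun_apply (2 *\<^sub>R blinfun_inner_right x)) (at x)" for x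
    unfolding power2_norm_eq_inner
    by (rule derivative_eq_intros refl)+
       (simp add: scaleR_blinfun.rep_eq blinfun_inner_right.rep_eq inner_commute)
  show "continuous_on UNIV (\<lambda>x::'a. 2 *\<^sub>R blinfun_inner_right x)"
    by (intro continuous_intros bounded_linear.continuous_on[OF bounded_linear_blinfun_inner_right])
qed

lemma C1_radial_cutoff:
  assumes "0 \<le> r" "r < R"
  obtains \<theta> :: "'a::real_inner \<Rightarrow> real" where "C1_on UNIV \<theta>"
    "\<And>x. 0 \<le> \<theta> x" "\<And>x. \<theta> x \<le> 1"
    "\<And>x. norm x \<le> r \<Longrightarrow> \<theta> x = 1" "\<And>x. R \<le> norm x \<Longrightarrow> \<theta> x = 0"
proof
  \<comment> \<open>The squared norm, unlike the norm, is differentiable at the origin. The argument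
    of \<open>smoothstep\<close> is affine in it, with value 1 at radius \<open>r\<close> and 0 at
    radius \<open>R\<close>.\<close>
  let ?\<theta> = "\<lambda>x::'a. smoothstep ((R\<^sup>2 + (- 1) *\<^sub>R (norm x)\<^sup>2) / (R\<^sup>2 - r\<^sup>2))"
  have pos: "R\<^sup>2 - r\<^sup>2 > 0"
    using assms power_strict_mono[of r R 2] by auto
  show "C1_on UNIV ?\<theta>"
  proof (rule C1_on_compose[OF _ C1_on_smoothstep])
    have "C1_on UNIV (\<lambda>x::'a. R\<^sup>2 + (- 1) *\<^sub>R (norm x)\<^sup>2)"
      by (rule C1_on_add[OF C1_on_const C1_on_scaleR[OF C1_on_const C1_on_norm_squared]])
    then show "C1_on UNIV (\<lambda>x::'a. (R\<^sup>2 + (- 1) *\<^sub>R (norm x)\<^sup>2) / (R\<^sup>2 - r\<^sup>2))"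
      by (rule C1_on_compose[where V=UNIV, OF _ C1_on_linear[OF bounded_linear_divide]]) simp
  qed simp
  show "?\<theta> x = 1" if "norm x \<le> r" for x
    using that pos assms power_mono[of "norm x" r 2]
    by (intro smoothstep_eq_1) (auto simp: field_simps)
  show "?\<theta> x = 0" if "R \<le> norm x" for x
    using that pos assms power_mono[of R "norm x" 2]
    by (intro smoothstep_eq_0) (auto simp: field_simps)
qed (auto simp: smoothstep_bounds)

text \<open>The derivative bound makes \<open>u\<close> a contraction: the Lipschitz estimate gives
  injectivity, Banach's fixed point theorem surjectivity, and the bound on \<open>u' x\<close> makes
  every derivative injective.\<close>

lemma C1_diffeomorphism_perturb_id:
  fixes u :: "'a::euclidean_space \<Rightarrow> 'a"
  assumes u: "\<And>x. (u has_derivative blinfun_apply (u' x)) (at x)" "continuous_on UNIV u'"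
    and c: "\<And>x. norm (u' x) \<le> c" "c < 1"
  shows "C1_diffeomorphism UNIV UNIV (\<lambda>x. x + u x)"
proof -
  have lip: "norm (u x - u y) \<le> c * norm (x - y)" for x y
    by (rule differentiable_bound[where f'="\<lambda>x. blinfun_apply (u' x)" and S=UNIV])
       (use u c in \<open>auto simp: norm_blinfun.rep_eq\<close>)
  have inj: "inj (\<lambda>x. x + u x)"
  proof (rule injI)
    fix x y assume "x + u x = y + u y"
    then have "u y - u x = x - y" by (simp add: algebra_simps)
    then have "norm (x - y) \<le> c * norm (x - y)"
      using lip[of y x] by (simp add: norm_minus_commute)
    then have "(1 - c) * norm (x - y) \<le> 0" by (simp add: algebra_simps)
    then show "x = y" using c(2) by (simp add: mult_le_0_iff)
  qed
  have surj: "y \<in> range (\<lambda>x. x + u x)" for y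
  proof -
    have "c \<ge> 0" using c(1)[of 0] norm_ge_zero order_trans by blast
    \<comment> \<open>Solving x + u x = y amounts to finding a fixed point of the contraction x -> y
      - u x.\<close>
    then have "\<exists>!x. y - u x = x"
      using banach_fix_type[of c "\<lambda>x. y - u x"] lip c(2)
      by (auto simp: dist_norm norm_minus_commute)
    then show ?thesis by (metis diff_add_cancel rangeI)
  qed
  have "C1_diffeomorphism UNIV (range (\<lambda>x. x + u x)) (\<lambda>x. x + u x)"
  proof (rule C1_diffeomorphism_of_inj_on[where f'="\<lambda>x. id_blinfun + u' x"])
    show "((\<lambda>x. x + u x) has_derivative blinfun_apply (id_blinfun + u' x)) (at x)" for x
      by (auto intro!: derivative_eq_intros u simp: blinfun.bilinear_simps)
    show "inj (blinfun_apply (id_blinfun + u' x))" for x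
    proof (rule injI)
      fix v w assume "blinfun_apply (id_blinfun + u' x) v = blinfun_apply (id_blinfun + u' x) w"
      then have "v - w = - blinfun_apply (u' x) (v - w)"
        by (simp add: blinfun.bilinear_simps algebra_simps)
      then have "norm (v - w) \<le> norm (u' x) * norm (v - w)"
        by (metis norm_blinfun norm_minus_cancel)
      also have "\<dots> \<le> c * norm (v - w)" by (intro mult_right_mono c) auto
      finally have "(1 - c) * norm (v - w) \<le> 0" by (simp add: algebra_simps)
      then show "v = w" using c(2) by (simp add: mult_le_0_iff)
    qed
  qed (use inj in \<open>auto intro!: continuous_intros u\<close>)
  moreover have "range (\<lambda>x. x + u x) = UNIV"
    using surj by blast
  ultimately show ?thesis by simp
qed

lemma derivative_outside_support:
  fixes f :: "'a::euclidean_space \<Rightarrow> 'b::real_normed_vector"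
  assumes "(f has_derivative blinfun_apply D) (at x)"
    and "\<And>x. r \<le> norm x \<Longrightarrow> f x = 0" and "r < norm x"
  shows "D = 0"
proof -
  have "((\<lambda>x. 0) has_derivative blinfun_apply D) (at x)"
    by (rule has_derivative_transform_within_open[OF assms(1), of "- cball 0 r"])
       (use assms(2,3) in auto)
  then have "blinfun_apply D = (\<lambda>h. 0)"
    by (rule has_derivative_unique) simp
  then show ?thesis by (auto intro: blinfun_eqI)
qed

lemma C1_compact_support_bounded_derivative:
  fixes f :: "'a::euclidean_space \<Rightarrow> 'b::real_normed_vector"
  assumes f: "\<And>x. (f has_derivative blinfun_apply (f' x)) (at x)" "continuous_on UNIV f'"
    and supp: "\<And>x. r \<le> norm x \<Longrightarrow> f x = 0"
  obtains M where "M > 0" "\<And>x. norm (f' x) \<le> M"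
proof -
  have "compact (f' ` cball 0 r)"
    by (rule compact_continuous_image) (use f in \<open>auto intro: continuous_on_subset\<close>)
  then obtain M where M: "M > 0" "\<And>x. norm x \<le> r \<Longrightarrow> norm (f' x) \<le> M"
    using compact_imp_bounded bounded_pos by (metis (no_types, lifting) imageI mem_cball_0)
  moreover have "norm (f' x) \<le> M" if "r < norm x" for x
    using derivative_outside_support[OF f(1) supp that] M(1) by simp
  ultimately show ?thesis by (meson not_less that)
qed

lemma C1_diffeomorphism_euler_step:
  fixes Y :: "'a::euclidean_space \<Rightarrow> 'a"
  assumes "C1_on UNIV Y" and supp: "\<And>x. r \<le> norm x \<Longrightarrow> Y x = 0"
  obtains \<delta> where "\<delta> > 0"
    "\<And>h. 0 \<le> h \<Longrightarrow> h < \<delta> \<Longrightarrow> C1_diffeomorphism UNIV UNIV (\<lambda>x. x + h *\<^sub>R Y x)"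
proof -
  obtain Y' where Y: "\<And>x. (Y has_derivative blinfun_apply (Y' x)) (at x)" "continuous_on UNIV Y'"
    using assms(1) C1_onE by (metis UNIV_I)
  obtain M where M: "M > 0" "\<And>x. norm (Y' x) \<le> M"
    using C1_compact_support_bounded_derivative[OF Y supp] by blast
  show ?thesis
  proof
    show "1 / M > 0" using M by simp
    fix h :: real assume h: "0 \<le> h" "h < 1 / M"
    show "C1_diffeomorphism UNIV UNIV (\<lambda>x. x + h *\<^sub>R Y x)"
    proof (rule C1_diffeomorphism_perturb_id[where u'="\<lambda>x. h *\<^sub>R Y' x" and c="h * M"])
      show "((\<lambda>x. h *\<^sub>R Y x) has_derivative blinfun_apply (h *\<^sub>R Y' x)) (at x)" for x
        by (auto intro!: derivative_eq_intros Y simp: blinfun.bilinear_simps)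
      show "continuous_on UNIV (\<lambda>x. h *\<^sub>R Y' x)" by (intro continuous_intros Y)
      show "norm (h *\<^sub>R Y' x) \<le> h * M" for x using h M by (simp add: mult_left_mono)
      show "h * M < 1" using h M by (simp add: pos_less_divide_eq)
    qed
  qed
qed

text \<open>The map is an iterated Euler step of the cut-off radial field -\<theta>(x) x. On the
  ball of radius \<open>r\<close> one step is multiplication by 1 - h, so enough steps bring that
  ball within radius \<open>\<epsilon>\<close>.\<close>

lemma C1_shrinking_diffeomorphism:
  assumes "0 < r" "0 < \<epsilon>"
  obtains \<sigma> :: "'a::euclidean_space \<Rightarrow> 'a" where "C1_diffeomorphism UNIV UNIV \<sigma>"
    "\<And>x. r + 1 \<le> norm x \<Longrightarrow> \<sigma> x = x" "\<And>x. norm x \<le> r \<Longrightarrow> norm (\<sigma> x) \<le> \<epsilon>"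
proof -
  obtain \<theta> :: "'a \<Rightarrow> real" where \<theta>: "C1_on UNIV \<theta>" "\<And>x. 0 \<le> \<theta> x" "\<And>x. \<theta> x \<le> 1"
    "\<And>x. norm x \<le> r \<Longrightarrow> \<theta> x = 1" "\<And>x. r + 1 \<le> norm x \<Longrightarrow> \<theta> x = 0"
    by (rule C1_radial_cutoff[of r "r + 1", where 'a='a]) (use assms in auto)
  obtain \<delta> where \<delta>: "\<delta> > 0"
    "\<And>h. 0 \<le> h \<Longrightarrow> h < \<delta> \<Longrightarrow> C1_diffeomorphism UNIV UNIV (\<lambda>x::'a. x + h *\<^sub>R (\<theta> x *\<^sub>R (- x)))"
    by (rule C1_diffeomorphism_euler_step[of "\<lambda>x. \<theta> x *\<^sub>R (- x)" "r + 1"])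
       (simp_all add: \<theta> C1_on_scaleR[OF \<theta>(1) C1_on_linear[OF bounded_linear_minus[OF bounded_linear_ident]]]
          del: scaleR_minus_right)
  define h where "h = min (\<delta> / 2) (1 / 2)"
  have h: "0 < h" "h < \<delta>" "h < 1" using \<delta>(1) by (auto simp: h_def)
  define s where "s = (\<lambda>x::'a. x + h *\<^sub>R (\<theta> x *\<^sub>R (- x)))"
  have "(\<lambda>n. (1 - h) ^ n * r) \<longlonglongrightarrow> 0 * r"
    using h by (intro tendsto_intros LIMSEQ_power_zero) auto
  then have "\<forall>\<^sub>F n in sequentially. (1 - h) ^ n * r < \<epsilon>"
    using assms(2) by (intro order_tendstoD) auto
  then obtain n where n: "(1 - h) ^ n * r < \<epsilon>"
    using eventually_happens'[OF sequentially_bot] by blast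
  show ?thesis
  proof
    show "C1_diffeomorphism UNIV UNIV (s ^^ n)"
      unfolding s_def using \<delta>(2) h by (intro C1_diffeomorphism_funpow) auto
    show "(s ^^ n) x = x" if "r + 1 \<le> norm x" for x
      using that by (induction n) (auto simp: s_def \<theta>(5))
    show "norm ((s ^^ n) x) \<le> \<epsilon>" if x: "norm x \<le> r" for x
    proof -
      \<comment> \<open>The norm bound is carried through the induction because it keeps every
        iterate where \<theta> = 1.\<close>
      have "norm ((s ^^ k) x) \<le> r \<and> (s ^^ k) x = (1 - h) ^ k *\<^sub>R x" for k
      proof (induction k)
        case (Suc k)
        then have "\<theta> ((s ^^ k) x) = 1" by (blast intro: \<theta>(4))
        then have "(s ^^ Suc k) x = (s ^^ k) x - h *\<^sub>R (s ^^ k) x"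
          by (simp add: s_def)
        also have "\<dots> = (1 - h) ^ Suc k *\<^sub>R x"
          using Suc by (simp add: algebra_simps)
        finally have e: "(s ^^ Suc k) x = (1 - h) ^ Suc k *\<^sub>R x" .
        have "(1 - h) ^ Suc k * norm x \<le> 1 * r"
          using h x by (intro mult_mono power_le_one) auto
        then show ?case using e h by simp
      qed (use x in simp)
      then have "norm ((s ^^ n) x) = (1 - h) ^ n * norm x" using h by simp
      also have "\<dots> \<le> (1 - h) ^ n * r" using h x by (intro mult_left_mono) auto
      finally show ?thesis using n by simp
    qed
  qed
qed

subsection \<open>Extension of embeddings from compact sets\<close>

lemma C1_diffeomorphism_linear:
  fixes A B :: "'a::real_normed_vector \<Rightarrow>\<^sub>L 'a"
  assumes "\<And>x. A (B x) = x" "\<And>x. B (A x) = x"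
  shows "C1_diffeomorphism UNIV UNIV (\<lambda>x. c + blinfun_apply A x)"
proof (rule C1_diffeomorphismI[where g="\<lambda>y. blinfun_apply B (y + - c)"])
  show "C1_on UNIV (\<lambda>x. c + blinfun_apply A x)"
    by (intro C1_on_add C1_on_const C1_on_linear blinfun.bounded_linear_right)
  show "C1_on UNIV (\<lambda>y. blinfun_apply B (y + - c))"
    by (rule C1_on_compose[where V=UNIV, OF _ C1_on_linear[OF blinfun.bounded_linear_right]])
       (simp_all only: C1_on_add C1_on_const C1_on_id subset_UNIV)
qed (use assms in auto)

lemma C1_diffeomorphism_derivative_invertible:
  assumes "C1_diffeomorphism U V f" "x \<in> U"
    and f: "(f has_derivative blinfun_apply A) (at x)"
  obtains B where "\<And>v. blinfun_apply B (blinfun_apply A v) = v" "\<And>v. blinfun_apply A (blinfun_apply B v) = v"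
proof -
  define g where "g = inv_into U f"
  have d: "open U" "open V" "bij_betw f U V" "C1_on V g"
    using assms(1) by (auto simp: C1_diffeomorphism_def g_def)
  have y: "f x \<in> V" and gf: "\<And>z. z \<in> U \<Longrightarrow> g (f z) = z" and fg: "\<And>z. z \<in> V \<Longrightarrow> f (g z) = z"
    using d(3) assms(2) by (auto simp: bij_betw_def g_def f_inv_into_f)
  obtain B where B: "(g has_derivative blinfun_apply B) (at (f x))"
    using d(4) y by (metis C1_onE)
  have "((\<lambda>z. g (f z)) has_derivative (\<lambda>v. B (A v))) (at x)"
    using diff_chain_at[OF f B] by (simp add: o_def)
  then have "((\<lambda>z. z) has_derivative (\<lambda>v. B (A v))) (at x)"
    by (rule has_derivative_transform_within_open[OF _ d(1) assms(2)]) (rule gf)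
  from has_derivative_unique[OF this has_derivative_ident]
  have 1: "B (A v) = v" for v by metis
  have "((\<lambda>z. f (g z)) has_derivative (\<lambda>v. A (B v))) (at (f x))"
    using diff_chain_at[OF B] f gf[OF assms(2)] by (simp add: o_def)
  then have "((\<lambda>z. z) has_derivative (\<lambda>v. A (B v))) (at (f x))"
    by (rule has_derivative_transform_within_open[OF _ d(2) y]) (rule fg)
  from has_derivative_unique[OF this has_derivative_ident]
  have 2: "A (B v) = v" for v by metis
  show ?thesis using 1 2 that by blast
qed

text \<open>Normalised by \<open>B\<close>, the map \<open>f\<close> differs from the identity by a
  remainder \<open>w\<close> that vanishes to first order at 0. A cutoff at scale
  \<open>\<epsilon>\<close> costs a factor of order 1/\<epsilon> in the derivative, but there
  \<open>w\<close> is of size \<delta> \<epsilon>, so the cut-off remainder is still a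
  contraction.\<close>

lemma C1_diffeomorphism_extends_from_small_ball:
  fixes f :: "'a::euclidean_space \<Rightarrow> 'a"
  assumes "C1_on UNIV f" and f0: "(f has_derivative blinfun_apply A) (at 0)"
    and AB: "\<And>v. blinfun_apply B (blinfun_apply A v) = v"
      "\<And>v. blinfun_apply A (blinfun_apply B v) = v"
  obtains F \<epsilon> where "C1_diffeomorphism UNIV UNIV F" "\<epsilon> > 0" "\<And>x. norm x \<le> \<epsilon> \<Longrightarrow> F x = f x"
proof -
  obtain f' where f: "\<And>x. (f has_derivative blinfun_apply (f' x)) (at x)" "continuous_on UNIV f'"
    using assms(1) C1_onE by (metis UNIV_I)
  have f'0: "f' 0 = A"
    using has_derivative_unique[OF f(1)[of 0] f0] by (metis blinfun_apply_inverse)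
  obtain \<theta> :: "'a \<Rightarrow> real" where \<theta>: "C1_on UNIV \<theta>" "\<And>x. 0 \<le> \<theta> x" "\<And>x. \<theta> x \<le> 1"
    "\<And>x. norm x \<le> 1 \<Longrightarrow> \<theta> x = 1" "\<And>x. 2 \<le> norm x \<Longrightarrow> \<theta> x = 0"
    by (rule C1_radial_cutoff[of 1 2, where 'a='a]) auto
  obtain \<theta>' where \<theta>': "\<And>x. (\<theta> has_derivative blinfun_apply (\<theta>' x)) (at x)" "continuous_on UNIV \<theta>'"
    using \<theta>(1) C1_onE by (metis UNIV_I)
  obtain M where M: "M > 0" "\<And>x. norm (\<theta>' x) \<le> M"
    using C1_compact_support_bounded_derivative[OF \<theta>' \<theta>(5)] by blast
  \<comment> \<open>The two contributions to the derivative of \<open>u\<close> are at most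
    \<open>\<delta>\<close> and \<open>\<delta> * 2 * M\<close>; this choice makes their sum
    1/2.\<close>
  define \<delta> where "\<delta> = 1 / (2 * (1 + 2 * M))"
  have \<delta>: "\<delta> > 0" "\<delta> * (1 + 2 * M) = 1/2" using M by (auto simp: \<delta>_def field_simps)
  define w where "w = (\<lambda>x. blinfun_apply B (f x - f 0) - x)"
  define w' where "w' = (\<lambda>x. (B o\<^sub>L f' x) - id_blinfun)"
  have w: "(w has_derivative blinfun_apply (w' x)) (at x)" for x
  proof -
    have "((\<lambda>x. f x - f 0) has_derivative (\<lambda>v. f' x v - 0)) (at x)"
      by (intro has_derivative_diff f has_derivative_const)
    from has_derivative_diff[OF bounded_linear.has_derivative[OF blinfun.bounded_linear_right this]
        has_derivative_ident]
    show ?thesis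
      unfolding w_def by (rule has_derivative_eq_rhs)
        (simp add: w'_def fun_eq_iff minus_blinfun.rep_eq id_blinfun.rep_eq)
  qed
  have cw': "continuous_on UNIV w'"
    unfolding w'_def by (intro continuous_intros f)
  have w0: "w 0 = 0" "w' 0 = 0"
    by (auto simp: w_def w'_def f'0 AB blinfun.zero_right intro!: blinfun_eqI
        simp: minus_blinfun.rep_eq id_blinfun.rep_eq zero_blinfun.rep_eq)
  have "\<forall>\<^sub>F x in nhds 0. dist (w' x) (w' 0) < \<delta>"
    using cw' \<delta>(1) by (simp add: continuous_on_eq_continuous_at isCont_def tendsto_at_iff_tendsto_nhds tendstoD)
  then obtain d where d: "d > 0" "\<And>x. norm x < d \<Longrightarrow> norm (w' x) < \<delta>"
    by (auto simp: eventually_nhds_metric w0)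
  \<comment> \<open>The rescaled cutoff vanishes outside radius 2 \<epsilon>, which has to stay
    below \<open>d\<close>.\<close>
  define \<epsilon> where "\<epsilon> = d / 3"
  have \<epsilon>: "\<epsilon> > 0" using d by (simp add: \<epsilon>_def)
  have w'_small: "norm (w' x) \<le> \<delta>" if "norm x \<le> 2 * \<epsilon>" for x
    using d(2)[of x] d(1) that by (simp add: \<epsilon>_def)
  have w_small: "norm (w x) \<le> \<delta> * (2 * \<epsilon>)" if "norm x \<le> 2 * \<epsilon>" for x
  proof -
    have "norm (w x - w 0) \<le> \<delta> * norm (x - 0)"
      by (rule differentiable_bound[where f'="\<lambda>x. blinfun_apply (w' x)" and S="cball 0 (2 * \<epsilon>)"])
         (use w w'_small \<epsilon> that in \<open>auto simp: norm_blinfun.rep_eq[symmetric] intro: has_derivative_at_withinI\<close>)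
    also have "\<dots> \<le> \<delta> * (2 * \<epsilon>)" using that \<delta> by (intro mult_left_mono) auto
    finally show ?thesis by (simp add: w0)
  qed
  define u where "u = (\<lambda>x. \<theta> ((1/\<epsilon>) *\<^sub>R x) *\<^sub>R w x)"
  define u' where "u' = (\<lambda>x. \<theta> ((1/\<epsilon>) *\<^sub>R x) *\<^sub>R w' x +
    (1/\<epsilon>) *\<^sub>R (blinfun_scaleR_left (w x) o\<^sub>L \<theta>' ((1/\<epsilon>) *\<^sub>R x)))"
  have u: "(u has_derivative blinfun_apply (u' x)) (at x)" for x
  proof -
    have "((\<lambda>x. \<theta> ((1/\<epsilon>) *\<^sub>R x)) has_derivative (\<lambda>v. \<theta>' ((1/\<epsilon>) *\<^sub>R x) ((1/\<epsilon>) *\<^sub>R v))) (at x)"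
      by (rule has_derivative_compose[OF _ \<theta>'(1)]) (intro derivative_intros)
    from has_derivative_scaleR[OF this w]
    show ?thesis
      unfolding u_def by (rule has_derivative_eq_rhs)
        (simp add: u'_def fun_eq_iff plus_blinfun.rep_eq scaleR_blinfun.rep_eq blinfun.scaleR_right)
  qed
  have cu': "continuous_on UNIV u'"
  proof -
    have "continuous_on UNIV (\<lambda>x. \<theta> ((1/\<epsilon>) *\<^sub>R x))"
      by (rule continuous_on_compose2[OF C1_on_imp_continuous_on[OF \<theta>(1)]])
         (auto intro!: continuous_intros)
    moreover have "continuous_on UNIV (\<lambda>x. \<theta>' ((1/\<epsilon>) *\<^sub>R x))"
      by (rule continuous_on_compose2[OF \<theta>'(2)]) (auto intro!: continuous_intros)
    moreover have "continuous_on UNIV w"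
      using w by (meson continuous_at_imp_continuous_on has_derivative_continuous)
    ultimately show ?thesis
      unfolding u'_def
      by (intro continuous_intros cw' bounded_linear.continuous_on[OF bounded_linear_blinfun_scaleR_left])
  qed
  have nu': "norm (u' x) \<le> 1/2" for x
  proof (cases "norm x \<le> 2 * \<epsilon>")
    case True
    have nl: "norm (blinfun_scaleR_left (w x)) \<le> norm (w x)"
      by (rule norm_blinfun_bound) (auto simp: mult.commute)
    have "norm (\<theta> ((1/\<epsilon>) *\<^sub>R x) *\<^sub>R w' x) \<le> 1 * \<delta>"
      unfolding norm_scaleR by (intro mult_mono w'_small True) (use \<theta>(2,3) in auto)
    moreover have "norm (blinfun_scaleR_left (w x) o\<^sub>L \<theta>' ((1/\<epsilon>) *\<^sub>R x)) \<le> (\<delta> * (2 * \<epsilon>)) * M"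
      by (rule order_trans[OF norm_blinfun_compose])
         (use nl w_small[OF True] M \<delta>(1) \<epsilon> in \<open>auto intro!: mult_mono\<close>)
    then have "norm ((1/\<epsilon>) *\<^sub>R (blinfun_scaleR_left (w x) o\<^sub>L \<theta>' ((1/\<epsilon>) *\<^sub>R x))) \<le> \<delta> * 2 * M"
      using \<epsilon> by (simp add: field_simps)
    ultimately have "norm (u' x) \<le> 1 * \<delta> + \<delta> * 2 * M"
      unfolding u'_def by (rule norm_triangle_le[OF add_mono])
    then show ?thesis using \<delta>(2) by (simp add: algebra_simps)
  next
    case False
    then have "2 < norm ((1/\<epsilon>) *\<^sub>R x)" using \<epsilon> by (simp add: field_simps)
    then have "\<theta> ((1/\<epsilon>) *\<^sub>R x) = 0" "\<theta>' ((1/\<epsilon>) *\<^sub>R x) = 0"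
      using \<theta>(5) derivative_outside_support[OF \<theta>'(1) \<theta>(5)] by auto
    then show ?thesis by (simp add: u'_def)
  qed
  have "C1_diffeomorphism UNIV UNIV (\<lambda>x. x + u x)"
    by (rule C1_diffeomorphism_perturb_id[OF u cu' nu']) simp
  then have "C1_diffeomorphism UNIV UNIV (\<lambda>x. f 0 + A (x + u x))"
    by (rule C1_diffeomorphism_compose[OF _ C1_diffeomorphism_linear[OF AB(2,1)]])
  moreover have "f 0 + A (x + u x) = f x" if "norm x \<le> \<epsilon>" for x
  proof -
    have "u x = w x" using \<theta>(4)[of "(1/\<epsilon>) *\<^sub>R x"] \<epsilon> that by (simp add: u_def)
    then show ?thesis by (simp add: w_def AB)
  qed
  ultimately show ?thesis using that \<epsilon> by blast
qed

text \<open>The conjugate of \<open>\<sigma>\<close> by \<open>f\<close> lives on \<open>V\<close>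
  and is the identity off the compact image of the ball of radius \<open>R\<close>. \<open>V\<close>
  and the open complement of that image cover the space, so continuation by the identity is
  C^1.\<close>

lemma C1_diffeomorphism_transport:
  fixes f :: "'a::euclidean_space \<Rightarrow> 'a"
  assumes f: "C1_diffeomorphism UNIV V f"
    and \<sigma>: "C1_diffeomorphism UNIV UNIV \<sigma>" and fix_out: "\<And>x. R \<le> norm x \<Longrightarrow> \<sigma> x = x"
  obtains \<Theta> where "C1_diffeomorphism UNIV UNIV \<Theta>" "\<And>x. \<Theta> (f x) = f (\<sigma> x)"
proof -
  define g where "g = inv_into UNIV f"
  have V: "open V" "bij_betw f UNIV V" "C1_on UNIV f" "C1_on V g"
    using f by (auto simp: C1_diffeomorphism_def g_def)
  have fV: "f x \<in> V" and gf: "g (f x) = x" for x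
    using V(2) by (auto simp: g_def bij_betw_def)
  have fg: "f (g y) = y" if "y \<in> V" for y
    using V(2) that by (auto simp: g_def bij_betw_def f_inv_into_f)
  \<comment> \<open>\<open>s\<close> is a parameter so that one argument serves both
    \<open>\<sigma>\<close> and its inverse.\<close>
  define T where "T = (\<lambda>s y. if y \<in> V then f (s (g y)) else y)"
  have C1: "C1_on UNIV (T s)" if s: "C1_on UNIV s" "\<And>x. R \<le> norm x \<Longrightarrow> s x = x" for s
  proof (rule C1_on_locally)
    fix y
    have VT: "C1_on V (T s)"
    proof (rule C1_on_cong[OF _ V(1)])
      show "C1_on V (\<lambda>y. f (s (g y)))"
        by (rule C1_on_compose[where V=UNIV, OF C1_on_compose[where V=UNIV, OF V(4) s(1)] V(3)]) auto
    qed (simp add: T_def)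
    have "compact (f ` cball 0 R)"
      using C1_on_imp_continuous_on[OF V(3)]
      by (intro compact_continuous_image) (auto intro: continuous_on_subset)
    then have op: "open (- f ` cball 0 R)"
      by (simp add: compact_imp_closed open_Compl)
    have "T s y = y" if "y \<in> - f ` cball 0 R" for y
    proof (cases "y \<in> V")
      case True
      then have "\<not> norm (g y) \<le> R" using that fg[OF True] by (metis ComplD imageI mem_cball_0)
      then show ?thesis using s(2) fg True by (simp add: T_def)
    qed (simp add: T_def)
    then have "C1_on (- f ` cball 0 R) (T s)"
      using C1_on_cong[OF C1_on_id op] by blast
    moreover have "y \<in> V \<or> y \<in> - f ` cball 0 R" using fV by auto
    ultimately show "\<exists>S. open S \<and> y \<in> S \<and> C1_on S (T s)"
      using V(1) VT op by blast
  qed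
  define \<rho> where "\<rho> = inv_into UNIV \<sigma>"
  have \<rho>: "C1_on UNIV \<rho>" "C1_on UNIV \<sigma>" "\<And>x. \<sigma> (\<rho> x) = x" "\<And>x. \<rho> (\<sigma> x) = x"
    using \<sigma> by (auto simp: C1_diffeomorphism_def \<rho>_def bij_betw_def surj_f_inv_f)
  have \<rho>_out: "\<rho> x = x" if "R \<le> norm x" for x
    using fix_out[OF that] \<rho>(4)[of x] by simp
  have TT: "T s (T t y) = y" if "\<And>x. s (t x) = x" for s t y
    using fV gf fg that by (simp add: T_def)
  have "C1_diffeomorphism UNIV UNIV (T \<sigma>)"
    by (rule C1_diffeomorphismI[where g="T \<rho>"])
       (use C1 \<rho> \<rho>_out fix_out TT in auto)
  moreover have "T \<sigma> (f x) = f (\<sigma> x)" for x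
    using fV gf by (simp add: T_def)
  ultimately show ?thesis using that by blast
qed

lemma C1_diffeomorphism_extend_from_compact:
  fixes f :: "'a::euclidean_space \<Rightarrow> 'a"
  assumes f: "C1_diffeomorphism UNIV V f" and C: "compact C"
  obtains g where "C1_diffeomorphism UNIV UNIV g" "\<And>x. x \<in> C \<Longrightarrow> g x = f x"
proof -
  have C1f: "C1_on UNIV f" using f by (simp add: C1_diffeomorphism_def)
  then obtain A where A: "(f has_derivative blinfun_apply A) (at 0)" by (metis C1_onE UNIV_I)
  obtain B where B: "\<And>v. blinfun_apply B (blinfun_apply A v) = v" "\<And>v. blinfun_apply A (blinfun_apply B v) = v"
    using C1_diffeomorphism_derivative_invertible[OF f _ A] by auto
  obtain F \<epsilon> where F: "C1_diffeomorphism UNIV UNIV F" "\<epsilon> > 0" "\<And>x. norm x \<le> \<epsilon> \<Longrightarrow> F x = f x"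
    using C1_diffeomorphism_extends_from_small_ball[OF C1f A B] by blast
  obtain r where r: "r > 0" "\<And>x. x \<in> C \<Longrightarrow> norm x \<le> r"
    using C compact_imp_bounded bounded_pos by metis
  obtain \<sigma> :: "'a \<Rightarrow> 'a" where \<sigma>: "C1_diffeomorphism UNIV UNIV \<sigma>"
    "\<And>x. r + 1 \<le> norm x \<Longrightarrow> \<sigma> x = x" "\<And>x. norm x \<le> r \<Longrightarrow> norm (\<sigma> x) \<le> \<epsilon>"
    using C1_shrinking_diffeomorphism[OF r(1) F(2)] by blast
  obtain \<Theta> where \<Theta>: "C1_diffeomorphism UNIV UNIV \<Theta>" "\<And>x. \<Theta> (f x) = f (\<sigma> x)"
    using C1_diffeomorphism_transport[OF f \<sigma>(1,2)] by blast
  show ?thesis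
  proof
    show "C1_diffeomorphism UNIV UNIV (\<lambda>x. inv_into UNIV \<Theta> (F (\<sigma> x)))"
      using C1_diffeomorphism_compose[OF C1_diffeomorphism_compose[OF \<sigma>(1) F(1)]
          C1_diffeomorphism_inv[OF \<Theta>(1)]] .
    show "inv_into UNIV \<Theta> (F (\<sigma> x)) = f x" if "x \<in> C" for x
    proof -
      \<comment> \<open>\<open>\<sigma>\<close> carries \<open>C\<close> into the ball where F = f,
        so F(\<sigma> x) = f(\<sigma> x) = \<Theta>(f x), and \<Theta> cancels.\<close>
      have "F (\<sigma> x) = \<Theta> (f x)" using F(3) \<sigma>(3) r(2)[OF that] \<Theta>(2) by simp
      moreover have "inj \<Theta>" using \<Theta>(1) by (simp add: C1_diffeomorphism_def bij_betw_def)
      ultimately show ?thesis by simp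
    qed
  qed
qed

subsection \<open>Engulfing\<close>

text \<open>Each new map is the old one precomposed with an engulfing map that fixes the current
  compact set, so values there never change again. These sets exhaust \<open>E\<close>, hence the
  sequence is eventually constant near each point of \<open>E\<close>; covering larger and larger
  balls makes the limit surjective.\<close>

lemma C1_diffeomorphism_engulfing:
  fixes E :: "'a::euclidean_space set"
  assumes E: "open E" and K: "compact K" "K \<subseteq> E"
    and engulf: "\<And>L B. compact L \<Longrightarrow> L \<subseteq> E \<Longrightarrow> compact B \<Longrightarrow>
      \<exists>g. C1_diffeomorphism UNIV UNIV g \<and> (\<forall>x\<in>L. g x = x) \<and> B \<subseteq> g ` E"
  obtains F where "C1_diffeomorphism E UNIV F" "\<And>x. x \<in> K \<Longrightarrow> F x = x"
proof -
  obtain C where C: "\<And>n. compact (C n)" "\<And>n. C n \<subseteq> E" "\<And>n. C n \<subseteq> interior (C (Suc n))"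
    "\<Union>(range C) = E" "\<And>K. \<lbrakk>compact K; K \<subseteq> E\<rbrakk> \<Longrightarrow> \<exists>N. \<forall>n\<ge>N. K \<subseteq> C n"
    using open_Union_compact_subsets[OF E] by metis
  \<comment> \<open>The state is a pair: the current diffeomorphism and a compact set on which it is
    frozen from then on.\<close>
  define P where "P = (\<lambda>(n::nat) (G :: 'a \<Rightarrow> 'a, L :: 'a set). C1_diffeomorphism UNIV UNIV G \<and>
    compact L \<and> L \<subseteq> E \<and> C n \<subseteq> L \<and> (\<forall>x\<in>K. x \<in> L \<and> G x = x))"
  define Q where "Q = (\<lambda>(n::nat) (G :: 'a \<Rightarrow> 'a, L :: 'a set) (G', L').
    L \<subseteq> L' \<and> (\<forall>x\<in>L. G' x = G x) \<and> cball 0 (real n) \<subseteq> G' ` L')"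
  have P0: "P 0 (\<lambda>x. x, K \<union> C 0)"
    using C1_diffeomorphism_id[OF open_UNIV, where 'a='a] K C by (auto simp: P_def)
  have step: "\<exists>GL'. P (Suc n) GL' \<and> Q n GL GL'" if "P n GL" for n GL
  proof -
    obtain G L where GL: "GL = (G, L)" by (cases GL)
    with that have G: "C1_diffeomorphism UNIV UNIV G" and L: "compact L" "L \<subseteq> E" "C n \<subseteq> L"
      and GK: "\<forall>x\<in>K. x \<in> L \<and> G x = x" by (auto simp: P_def)
    have pre: "compact (inv_into UNIV H ` cball 0 (real n))"
      if "C1_diffeomorphism UNIV UNIV H" for H :: "'a \<Rightarrow> 'a"
      using that C1_on_imp_continuous_on
      by (intro compact_continuous_image) (auto simp: C1_diffeomorphism_def intro: continuous_on_subset)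
    \<comment> \<open>For G o g to cover the ball, \<open>g\<close> has to cover its preimage under
      \<open>G\<close>.\<close>
    obtain g where g: "C1_diffeomorphism UNIV UNIV g" "\<forall>x\<in>L. g x = x"
      "inv_into UNIV G ` cball 0 (real n) \<subseteq> g ` E"
      using engulf[OF L(1,2) pre[OF G]] by blast
    define G' where "G' = (\<lambda>x. G (g x))"
    have G': "C1_diffeomorphism UNIV UNIV G'"
      unfolding G'_def by (rule C1_diffeomorphism_compose[OF g(1) G])
    have inv: "bij G" "bij g" "bij G'" using G g G' by (auto simp: C1_diffeomorphism_def)
    define L' where "L' = L \<union> C (Suc n) \<union> inv_into UNIV G' ` cball 0 (real n)"
    have ball: "y \<in> G' ` E" if "y \<in> cball 0 (real n)" for y
    proof -
      obtain x where "x \<in> E" "inv_into UNIV G y = g x" using g(3) \<open>y \<in> cball 0 (real n)\<close> by blast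
      then have "G' x = y" using inv(1) by (metis G'_def bij_inv_eq_iff)
      then show ?thesis using \<open>x \<in> E\<close> by blast
    qed
    have "L' \<subseteq> E"
    proof -
      have "inv_into UNIV G' y \<in> E" if "y \<in> cball 0 (real n)" for y
        using ball[OF that] inv(3) by (metis bij_inv_eq_iff imageE)
      then show ?thesis using L C by (auto simp: L'_def)
    qed
    moreover have "compact L'" unfolding L'_def by (intro compact_Un L C pre[OF G'])
    moreover have "cball 0 (real n) \<subseteq> G' ` L'"
      using inv(3) by (auto simp: L'_def image_Un image_image bij_is_surj surj_f_inv_f)
    ultimately have "P (Suc n) (G', L')" "Q n GL (G', L')"
      using G' GK g(2) by (auto simp: P_def Q_def GL L'_def G'_def)
    then show ?thesis by blast
  qed
  obtain GL where GL: "P n (GL n)" "Q n (GL n) (GL (Suc n))" for n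
    using dependent_nat_choice[of P Q] P0 step by metis
  define G where "G = (\<lambda>n. fst (GL n))"
  define L where "L = (\<lambda>n. snd (GL n))"
  have G: "C1_diffeomorphism UNIV UNIV (G n)" and L: "L n \<subseteq> E" "C n \<subseteq> L n"
    and GK: "x \<in> K \<Longrightarrow> x \<in> L n \<and> G n x = x" for n x
    using GL(1)[of n] by (auto simp: P_def G_def L_def split: prod.splits)
  have Suc: "L n \<subseteq> L (Suc n)" "x \<in> L n \<Longrightarrow> G (Suc n) x = G n x"
    "cball 0 (real n) \<subseteq> G (Suc n) ` L (Suc n)" for n x
    using GL(2)[of n] by (auto simp: Q_def G_def L_def split: prod.splits)
  have mono: "L n \<subseteq> L (n + k) \<and> (\<forall>x\<in>L n. G (n + k) x = G n x)" for n k
    by (induction k) (use Suc in \<open>auto, blast+\<close>)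
  \<comment> \<open>The first stage at which a point is frozen; every later stage gives the same
    value.\<close>
  define N where "N = (\<lambda>x. LEAST n. x \<in> L n)"
  define F where "F = (\<lambda>x. G (N x) x)"
  have F: "F x = G n x" if "x \<in> L n" for x n
  proof -
    have "x \<in> L (N x)" "N x \<le> n" unfolding N_def using that by (auto intro: LeastI Least_le)
    then show ?thesis using mono[of "N x" "n - N x"] by (simp add: F_def)
  qed
  \<comment> \<open>Two points are frozen at a common stage, which reduces injectivity of
    \<open>F\<close> to that of one \<open>G n\<close>.\<close>
  have ex: "\<exists>n. x \<in> L n \<and> y \<in> L n" if xy: "x \<in> E" "y \<in> E" for x y
  proof -
    have "\<exists>N. \<forall>n\<ge>N. {x, y} \<subseteq> C n" using xy by (intro C(5)) auto
    then show ?thesis using L(2) by blast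
  qed
  have Gd: "inj (G n)" "C1_on UNIV (G n)" for n
    using G[of n] by (auto simp: C1_diffeomorphism_def bij_is_inj)
  have inj: "inj_on F E"
    by (rule inj_onI) (metis ex F Gd(1) injD)
  have surj: "F ` E = UNIV"
  proof -
    have "y \<in> F ` E" for y
    proof -
      obtain n where "norm y \<le> real n" using real_arch_simple by blast
      then have "y \<in> G (Suc n) ` L (Suc n)" using Suc(3)[of n] by (meson mem_cball_0 subsetD)
      then obtain x where "x \<in> L (Suc n)" "y = F x" using F by auto
      then show ?thesis using L(1) by blast
    qed
    then show ?thesis by blast
  qed
  \<comment> \<open>Derivatives require agreement of \<open>F\<close> with some \<open>G n\<close>
    on an open set, hence the interiors.\<close>
  have loc: "\<exists>n. x \<in> interior (C n)" if "x \<in> E" for x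
    using that C(3,4) by blast
  have FG: "F x = G n x" if "x \<in> interior (C n)" for x n
    using that L(2) interior_subset by (intro F) blast
  have "C1_on E F"
  proof (rule C1_on_locally)
    fix x assume "x \<in> E"
    then obtain n where n: "x \<in> interior (C n)" using loc by blast
    have "C1_on (interior (C n)) F"
      by (rule C1_on_cong[OF C1_on_subset[OF Gd(2)]]) (auto simp: FG)
    then show "\<exists>S. open S \<and> x \<in> S \<and> C1_on S F" using n open_interior by blast
  qed
  then obtain F' where F': "\<And>x. x \<in> E \<Longrightarrow> (F has_derivative blinfun_apply (F' x)) (at x)"
    "continuous_on E F'" using C1_onE by blast
  have "inj (blinfun_apply (F' x))" if x: "x \<in> E" for x
  proof -
    obtain n where n: "x \<in> interior (C n)" using loc x by blast
    have "(G n has_derivative blinfun_apply (F' x)) (at x)"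
      by (rule has_derivative_transform_within_open[OF F'(1)[OF x] open_interior n]) (rule FG)
    then obtain B where "\<And>v. blinfun_apply B (blinfun_apply (F' x) v) = v"
      using C1_diffeomorphism_derivative_invertible[OF G] by (metis UNIV_I)
    then show ?thesis by (metis injI)
  qed
  then have "C1_diffeomorphism E UNIV F"
    using C1_diffeomorphism_of_inj_on[OF E inj F'] surj by simp
  moreover have "F x = x" if "x \<in> K" for x
    using GK[OF that, of 0] F[of x 0] by simp
  ultimately show ?thesis using that by blast
qed

subsection \<open>Convergence of Euler polygons\<close>

lemma euler_iterate_dist:
  fixes X :: "'a::real_normed_vector \<Rightarrow> 'a"
  assumes M: "\<And>x. norm (X x) \<le> M" and h: "0 \<le> h"
  shows "norm (((\<lambda>x. x + h *\<^sub>R X x) ^^ i) z - ((\<lambda>x. x + h *\<^sub>R X x) ^^ j) z)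
    \<le> M * (h * \<bar>real i - real j\<bar>)"
proof -
  let ?e = "\<lambda>k. ((\<lambda>x. x + h *\<^sub>R X x) ^^ k) z"
  have *: "norm (?e (j + k) - ?e j) \<le> M * (h * real k)" for j k
  proof (induction k)
    case (Suc k)
    have "norm (?e (j + Suc k) - ?e j) \<le> norm (?e (j + k) - ?e j) + norm (h *\<^sub>R X (?e (j + k)))"
      using norm_triangle_ineq[of "?e (j + k) - ?e j" "h *\<^sub>R X (?e (j + k))"]
      by (simp add: algebra_simps)
    also have "\<dots> \<le> M * (h * real k) + h * M"
      using Suc M h by (intro add_mono) (auto intro: mult_left_mono)
    finally show ?case by (simp add: algebra_simps)
  qed simp
  show ?thesis
  proof (cases "j \<le> i")
    case True
    then show ?thesis using *[of j "i - j"] by (simp add: of_nat_diff)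
  next
    case False
    then show ?thesis using *[of i "j - i"] by (simp add: of_nat_diff norm_minus_commute)
  qed
qed

text \<open>Sum of increments, each within \<open>h * \<eta>\<close> of
  \<open>h *\<^sub>R v\<close>. The elapsed time is written as a difference of grid times, which
  converge separately when the step size tends to 0.\<close>

lemma euler_iterate_approx:
  fixes X :: "'a::real_normed_vector \<Rightarrow> 'a"
  defines "e \<equiv> (\<lambda>h z k. ((\<lambda>x. x + h *\<^sub>R X x) ^^ k) z)"
  assumes "0 \<le> h" "i \<le> j" "\<And>l. i \<le> l \<Longrightarrow> l < j \<Longrightarrow> norm (X (e h z l) - v) \<le> \<eta>"
  shows "norm (e h z j - e h z i - (real j * h - real i * h) *\<^sub>R v) \<le> (real j * h - real i * h) * \<eta>"
  using assms(3,4)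
proof (induction j rule: dec_induct)
  case (step j)
  have "e h z (Suc j) - e h z i - (real (Suc j) * h - real i * h) *\<^sub>R v
    = (e h z j - e h z i - (real j * h - real i * h) *\<^sub>R v) + h *\<^sub>R (X (e h z j) - v)"
    by (simp add: e_def algebra_simps)
  also have "norm \<dots> \<le> (real j * h - real i * h) * \<eta> + h * \<eta>"
    using step assms(2) by (intro norm_triangle_mono) (auto intro: mult_left_mono)
  finally show ?case by (simp add: algebra_simps)
qed simp

text \<open>Peano's argument: the polygons are Lipschitz up to an error of order \<open>h n\<close>,
  a diagonal subsequence converges at rational times and hence at all nonnegative times, and the
  estimate for short Euler runs becomes the differential equation in the limit. Since
  \<open>S\<close> is closed and the horizons \<open>T n\<close> grow without bound, the limit stays
  in \<open>S\<close>.\<close>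

lemma euler_limit_solution:
  fixes X :: "'a::euclidean_space \<Rightarrow> 'a"
  assumes X: "continuous_on UNIV X" and M: "\<And>x. norm (X x) \<le> M"
    and S: "closed S" and B: "bounded B"
    and h: "\<And>n. 0 < h n" "h \<longlonglongrightarrow> 0" and T: "filterlim T at_top sequentially"
    and z: "\<And>n. z n \<in> B"
    and inS: "\<And>n k. real k * h n \<le> T n \<Longrightarrow> ((\<lambda>x. x + h n *\<^sub>R X x) ^^ k) (z n) \<in> S"
  shows "\<exists>x. ode_solution_from X (x 0) x \<and> (\<forall>t\<ge>0. x t \<in> S)"
proof -
  define e where "e = (\<lambda>h z k. ((\<lambda>x. x + h *\<^sub>R X x) ^^ k) z)"
  \<comment> \<open>\<open>K n t\<close> is the index of the last grid time up to \<open>t\<close>,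
    so \<open>p n\<close> is a piecewise constant interpolation.\<close>
  define K where "K = (\<lambda>n t. nat \<lfloor>t / h n\<rfloor>)"
  define p where "p = (\<lambda>n t. e (h n) (z n) (K n t))"
  obtain R where R: "R > 0" "\<And>x. x \<in> B \<Longrightarrow> norm x \<le> R"
    using B bounded_pos by metis
  \<comment> \<open>The maximum makes the speed bound positive, so that it can be divided
    by.\<close>
  define m where "m = max M 1"
  have m: "m > 0" and Mm: "norm (X x) \<le> m" for x using M[of x] by (auto simp: m_def)
  have dist_e: "norm (e (h n) (z n) i - e (h n) (z n) j) \<le> m * (h n * \<bar>real i - real j\<bar>)" for n i j
    unfolding e_def using euler_iterate_dist[of X m "h n" i "z n" j] Mm h(1)[of n] by simp
  have K: "real (K n t) * h n \<le> t" "t - h n \<le> real (K n t) * h n" if "0 \<le> t" for n t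
  proof -
    have "real (K n t) = of_int \<lfloor>t / h n\<rfloor>"
      using that h(1)[of n] by (simp add: K_def)
    then have "real (K n t) \<le> t / h n" "t / h n - 1 \<le> real (K n t)" by linarith+
    then show "real (K n t) * h n \<le> t" "t - h n \<le> real (K n t) * h n"
      using h(1)[of n] by (auto simp: field_simps)
  qed
  have K_lim: "(\<lambda>n. real (K n t) * h n) \<longlonglongrightarrow> t" if "0 \<le> t" for t
  proof (rule tendsto_sandwich[where f="\<lambda>n. t - h n" and h="\<lambda>n. t"])
    show "(\<lambda>n. t - h n) \<longlonglongrightarrow> t"
      using tendsto_diff[OF tendsto_const h(2), of t] by simp
  qed (use K[OF that] in auto)
  have K_diff: "h n * \<bar>real (K n s) - real (K n t)\<bar> \<le> \<bar>s - t\<bar> + h n" if "0 \<le> s" "0 \<le> t" for n s t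
  proof -
    have "h n * \<bar>real (K n s) - real (K n t)\<bar> = \<bar>real (K n s) * h n - real (K n t) * h n\<bar>"
      using h(1)[of n] by (simp add: left_diff_distrib[symmetric] abs_mult)
    also have "\<dots> \<le> \<bar>s - t\<bar> + h n"
      using K[OF that(1), of n] K[OF that(2), of n] by linarith
    finally show ?thesis .
  qed
  have p_diff: "norm (p n s - p n t) \<le> m * (\<bar>s - t\<bar> + h n)" if "0 \<le> s" "0 \<le> t" for n s t
    unfolding p_def
    by (rule order_trans[OF dist_e mult_left_mono[OF K_diff[OF that]]]) (use m in simp)
  have p_bound: "norm (p n t) \<le> R + m * t" if "0 \<le> t" for n t
  proof -
    have "norm (p n t - z n) \<le> m * (h n * real (K n t))"
      using dist_e[of n "K n t" 0] by (simp add: p_def e_def)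
    also have "\<dots> \<le> m * t" using K(1)[OF that, of n] m by (simp add: mult.commute)
    finally show ?thesis
      using R(2)[OF z[of n]] norm_triangle_ineq2[of "p n t" "z n"] by linarith
  qed
  \<comment> \<open>Division by 1 + t provides the single bound R + m for all times that the
    diagonal selection asks for.\<close>
  obtain r where r: "strict_mono (r :: nat \<Rightarrow> nat)"
    "\<And>t. t \<in> \<rat> \<inter> {0..} \<Longrightarrow> \<exists>l. (\<lambda>n. p (r n) t /\<^sub>R (1 + t)) \<longlonglongrightarrow> l"
  proof (rule function_convergent_subsequence[of "\<rat> \<inter> {0..}" "\<lambda>n t. p n t /\<^sub>R (1 + t)" "R + m"])
    show "countable (\<rat> \<inter> {0::real..})" using countable_rat by blast
    show "norm (p n t /\<^sub>R (1 + t)) \<le> R + m" if "t \<in> \<rat> \<inter> {0..}" for n t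
    proof -
      have t: "0 \<le> t" using that by simp
      have "R + m * t \<le> (R + m) * (1 + t)"
        using t R m by (simp add: algebra_simps)
      then have "norm (p n t) \<le> (R + m) * (1 + t)" using p_bound[OF t, of n] by linarith
      then show ?thesis using t by (simp add: divide_simps flip: divide_inverse_commute)
    qed
  qed blast
  have h_r: "(\<lambda>n. h (r n)) \<longlonglongrightarrow> 0"
    using LIMSEQ_subseq_LIMSEQ[OF h(2) r(1)] by (simp add: o_def)
  have "convergent (\<lambda>n. p (r n) t)" if t: "0 \<le> t" for t
  proof (rule Cauchy_convergent, rule metric_CauchyI)
    fix \<epsilon> :: real assume \<epsilon>: "\<epsilon> > 0"
    \<comment> \<open>The Cauchy property is transferred from a nearby rational time; one
      \<epsilon>/(8 m) pays for the time gap and another for the step size.\<close>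
    obtain q where q: "q \<in> \<rat>" "t < q" "q < t + \<epsilon> / (8 * m)"
      using Rats_dense_in_real[of t "t + \<epsilon> / (8 * m)"] \<epsilon> m by auto
    then have q0: "0 \<le> q" using t by simp
    obtain l where "(\<lambda>n. p (r n) q /\<^sub>R (1 + q)) \<longlonglongrightarrow> l" using r(2) q q0 by auto
    from tendsto_scaleR[OF tendsto_const[of "1 + q"] this]
    have "(\<lambda>n. p (r n) q) \<longlonglongrightarrow> (1 + q) *\<^sub>R l" using q0 by simp
    then have "Cauchy (\<lambda>n. p (r n) q)" using LIMSEQ_imp_Cauchy by blast
    then obtain N1 where N1: "\<And>i j. N1 \<le> i \<Longrightarrow> N1 \<le> j \<Longrightarrow> dist (p (r i) q) (p (r j) q) < \<epsilon> / 2"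
      using \<epsilon> by (metis half_gt_zero metric_CauchyD)
    have "\<forall>\<^sub>F n in sequentially. h (r n) < \<epsilon> / (8 * m)"
      using h_r \<epsilon> m by (intro order_tendstoD) auto
    then obtain N2 where N2: "\<And>n. N2 \<le> n \<Longrightarrow> h (r n) < \<epsilon> / (8 * m)"
      by (auto simp: eventually_sequentially)
    have near: "dist (p (r n) t) (p (r n) q) < \<epsilon> / 4" if "N2 \<le> n" for n
    proof -
      have "dist (p (r n) t) (p (r n) q) \<le> m * (\<bar>t - q\<bar> + h (r n))"
        using p_diff[OF t q0] by (simp add: dist_norm)
      also have "\<dots> < m * (\<epsilon> / (8 * m) + \<epsilon> / (8 * m))"
        using q N2[OF that] m by (intro mult_strict_left_mono) auto
      also have "\<dots> = \<epsilon> / 4" using m by simp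
      finally show ?thesis .
    qed
    show "\<exists>N. \<forall>i\<ge>N. \<forall>j\<ge>N. dist (p (r i) t) (p (r j) t) < \<epsilon>"
    proof (intro exI allI impI)
      fix i j assume ij: "max N1 N2 \<le> i" "max N1 N2 \<le> j"
      have "dist (p (r i) t) (p (r j) t) \<le> dist (p (r i) t) (p (r i) q)
          + (dist (p (r i) q) (p (r j) q) + dist (p (r j) t) (p (r j) q))"
        by (meson add_left_mono dist_triangle dist_triangle2 order_trans)
      then show "dist (p (r i) t) (p (r j) t) < \<epsilon>"
        using near[of i] near[of j] N1[of i j] ij by simp
    qed
  qed
  then obtain x where x: "\<And>t. 0 \<le> t \<Longrightarrow> (\<lambda>n. p (r n) t) \<longlonglongrightarrow> x t"
    unfolding convergent_def by metis
  have xS: "x t \<in> S" if t: "0 \<le> t" for t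
  proof (rule Lim_in_closed_set[OF S _ _ x[OF t]])
    have "\<forall>\<^sub>F n in sequentially. t \<le> T n"
      using T by (simp add: filterlim_at_top)
    then have "\<forall>\<^sub>F n in sequentially. t \<le> T (r n)"
      using eventually_subseq[OF r(1)] by blast
    then show "\<forall>\<^sub>F n in sequentially. p (r n) t \<in> S"
    proof eventually_elim
      case (elim n)
      then show ?case
        unfolding p_def e_def using K(1)[OF t, of "r n"] by (intro inS) linarith
    qed
  qed simp
  have deriv: "\<exists>d>0. \<forall>s\<in>{0..}. norm (s - t) < d \<longrightarrow>
      norm (x s - x t - (s - t) *\<^sub>R X (x t)) \<le> \<eta> * norm (s - t)"
    if t: "0 \<le> t" and \<eta>: "\<eta> > 0" for t \<eta>
  proof -
    obtain \<delta> where \<delta>: "\<delta> > 0" "\<And>y. dist y (x t) < \<delta> \<Longrightarrow> dist (X y) (X (x t)) < \<eta>"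
      using X \<eta> unfolding continuous_on_iff by (metis UNIV_I)
    \<comment> \<open>\<open>t\<close> may be either endpoint, which covers difference quotients
      from both sides.\<close>
    have main: "norm (x b - x a - (b - a) *\<^sub>R X (x t)) \<le> (b - a) * \<eta>"
      if ab: "0 \<le> a" "a \<le> b" "t = a \<or> t = b" "b - a < \<delta> / (4 * m)" for a b
    proof -
      have b: "0 \<le> b" using ab by simp
      have ev: "\<forall>\<^sub>F n in sequentially. norm (p (r n) b - p (r n) a
          - (real (K (r n) b) * h (r n) - real (K (r n) a) * h (r n)) *\<^sub>R X (x t))
          \<le> (real (K (r n) b) * h (r n) - real (K (r n) a) * h (r n)) * \<eta>"
      proof -
        have 1: "\<forall>\<^sub>F n in sequentially. dist (p (r n) t) (x t) < \<delta> / 2"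
          using x[OF t] \<delta>(1) by (intro tendstoD) auto
        have 2: "\<forall>\<^sub>F n in sequentially. h (r n) < \<delta> / (4 * m)"
          using h_r \<delta>(1) m by (intro order_tendstoD) auto
        show ?thesis using 1 2
        proof eventually_elim
          case (elim n)
          let ?N = "r n"
          have Kab: "K ?N a \<le> K ?N b"
            unfolding K_def using ab(2) h(1)[of ?N]
            by (intro nat_mono floor_mono divide_right_mono) auto
          show ?case
            unfolding p_def e_def
          proof (rule euler_iterate_approx)
            show "0 \<le> h ?N" using h(1)[of ?N] by simp
            fix l assume l: "K ?N a \<le> l" "l < K ?N b"
            have "norm (e (h ?N) (z ?N) l - p ?N t) \<le> m * (h ?N * \<bar>real l - real (K ?N t)\<bar>)"
              unfolding p_def by (rule dist_e)
            \<comment> \<open>\<open>K ?N t\<close> is one of the two end indices, so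
              \<open>l\<close> is no farther from it than they are from each other.\<close>
            also have "\<dots> \<le> m * (h ?N * \<bar>real (K ?N b) - real (K ?N a)\<bar>)"
              using l ab(3) m h(1)[of ?N] by (intro mult_left_mono) auto
            also have "\<dots> \<le> m * (\<bar>b - a\<bar> + h ?N)"
              using K_diff[OF b ab(1), of ?N] m by (intro mult_left_mono) auto
            also have "\<dots> < m * (\<delta> / (4 * m) + \<delta> / (4 * m))"
              using ab elim(2) m by (intro mult_strict_left_mono) auto
            also have "\<dots> = \<delta> / 2" using m by simp
            finally have "dist (e (h ?N) (z ?N) l) (x t) < \<delta>"
              using elim(1) dist_triangle[of "e (h ?N) (z ?N) l" "x t" "p ?N t"]
              by (simp add: dist_norm)
            from \<delta>(2)[OF this]
            show "norm (X (((\<lambda>x. x + h ?N *\<^sub>R X x) ^^ l) (z ?N)) - X (x t)) \<le> \<eta>"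
              by (simp add: dist_norm e_def)
          qed (rule Kab)
        qed
      qed
      have Kr: "(\<lambda>n. real (K (r n) s) * h (r n)) \<longlonglongrightarrow> s" if "0 \<le> s" for s
        using LIMSEQ_subseq_LIMSEQ[OF K_lim[OF that] r(1)] by (simp add: o_def)
      show ?thesis
        by (rule tendsto_le[OF sequentially_bot _ _ ev])
           (intro tendsto_intros x Kr ab(1) b)+
    qed
    show ?thesis
    proof (intro exI conjI ballI impI)
      show "\<delta> / (4 * m) > 0" using \<delta>(1) m by simp
      fix s :: real assume s: "s \<in> {0..}" "norm (s - t) < \<delta> / (4 * m)"
      show "norm (x s - x t - (s - t) *\<^sub>R X (x t)) \<le> \<eta> * norm (s - t)"
      proof (cases "t \<le> s")
        case True
        then show ?thesis using main[of t s] s t by (simp add: mult.commute)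
      next
        case False
        have "x s - x t - (s - t) *\<^sub>R X (x t) = - (x t - x s - (t - s) *\<^sub>R X (x t))"
          by (simp add: algebra_simps)
        then have "norm (x s - x t - (s - t) *\<^sub>R X (x t)) = norm (x t - x s - (t - s) *\<^sub>R X (x t))"
          by (metis norm_minus_cancel)
        then show ?thesis using main[of s t] s False by (simp add: mult.commute)
      qed
    qed
  qed
  have "ode_solution_from X (x 0) x"
    unfolding ode_solution_from_def has_vector_derivative_def has_derivative_within_alt
    by (intro conjI allI impI bounded_linear_scaleR_left deriv refl) auto
  then show ?thesis using xS by blast
qed

text \<open>Attractivity speaks of exact solutions; compactness transfers it to Euler polygons, with
  a time bound uniform over starting points in \<open>B\<close>.\<close>

lemma euler_iterates_enter:
  fixes X :: "'a::euclidean_space \<Rightarrow> 'a"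
  assumes X: "continuous_on UNIV X" and M: "\<And>x. norm (X x) \<le> M"
    and attr: "globally_attractive X K\<^sub>0" and E: "open E" "K\<^sub>0 \<subseteq> E" and B: "bounded B"
  shows "\<exists>T>0. \<exists>h\<^sub>0>0. \<forall>h z. 0 < h \<longrightarrow> h < h\<^sub>0 \<longrightarrow> z \<in> B \<longrightarrow>
      (\<exists>k. real k * h \<le> T \<and> ((\<lambda>x. x + h *\<^sub>R X x) ^^ k) z \<in> E)"
    (is "?G")
proof (rule ccontr)
  assume neg: "\<not> ?thesis"
  define e where "e = (\<lambda>h k z. ((\<lambda>x. x + h *\<^sub>R X x) ^^ k) z)"
  define P where "P = (\<lambda>T h\<^sub>0 h z. 0 < h \<and> h < h\<^sub>0 \<and> z \<in> B \<and> (\<forall>k. real k * h \<le> T \<longrightarrow> e h k z \<notin> E))"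
  have "\<not> (\<exists>T>0. \<exists>h\<^sub>0>0. \<forall>h z. \<not> P T h\<^sub>0 h z)"
  proof
    assume "\<exists>T>0. \<exists>h\<^sub>0>0. \<forall>h z. \<not> P T h\<^sub>0 h z"
    then obtain T h\<^sub>0 where "T > 0" "h\<^sub>0 > 0" "\<And>h z. \<not> P T h\<^sub>0 h z" by blast
    then have ?G
      unfolding P_def e_def by (intro exI[of _ T] exI[of _ h\<^sub>0] conjI) simp_all
    then show False using neg by (rule notE[rotated])
  qed
  then have "\<exists>h z. P T h\<^sub>0 h z" if "0 < T" "0 < h\<^sub>0" for T h\<^sub>0
    using that by blast
  \<comment> \<open>Failure at horizon n + 1 with step bound 1/(n + 1) yields polygons that avoid
    \<open>E\<close> for longer and longer times.\<close>
  then have "\<forall>n. \<exists>h z. P (real (Suc n)) (inverse (real (Suc n))) h z"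
    by simp
  then obtain h z where P: "\<And>n. P (real (Suc n)) (inverse (real (Suc n))) (h n) (z n)"
    by metis
  have hz: "0 < h n" "h n < inverse (real (Suc n))" "z n \<in> B"
    "real k * h n \<le> real (Suc n) \<Longrightarrow> ((\<lambda>x. x + h n *\<^sub>R X x) ^^ k) (z n) \<in> - E" for n k
    using P[of n] by (simp_all add: P_def e_def)
  have h0: "h \<longlonglongrightarrow> 0"
    by (rule tendsto_sandwich[OF _ _ tendsto_const LIMSEQ_inverse_real_of_nat])
       (use hz(1,2) in \<open>auto intro!: always_eventually less_imp_le\<close>)
  have T: "filterlim (\<lambda>n. real (Suc n)) at_top sequentially"
    using filterlim_compose[OF filterlim_real_sequentially filterlim_Suc] by simp
  obtain x where x: "ode_solution_from X (x 0) x" "\<And>t. 0 \<le> t \<Longrightarrow> x t \<in> - E"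
    using euler_limit_solution[OF X M closed_Compl[OF E(1)] B hz(1) h0 T hz(3,4)] by blast
  \<comment> \<open>\<open>E\<close> itself is the open neighbourhood of
    \<open>K\<^sub>0\<close>.\<close>
  have "\<forall>\<^sub>F t in at_top. x t \<in> E"
    using attr E x(1) unfolding globally_attractive_def by blast
  then have "\<forall>\<^sub>F t in at_top. x t \<in> E \<and> 0 \<le> t"
    using eventually_ge_at_top by (rule eventually_conj)
  then obtain t where "x t \<in> E" "0 \<le> t"
    using eventually_happens'[OF trivial_limit_at_top_linorder] by blast
  then show False using x(2) by blast
qed

subsection \<open>Engulfing under condition B\<close>

text \<open>Otherwise escaping steps of size tending to 0 accumulate at a point of \<open>C\<close>
  where \<kappa> = 0. By the mean value theorem the derivative of \<kappa> along \<open>Y\<close> is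
  nonnegative there, against transversality.\<close>

lemma euler_step_preserves_sublevel:
  fixes Y :: "'a::euclidean_space \<Rightarrow> 'a" and \<kappa> :: "'a \<Rightarrow> real"
  assumes \<kappa>: "\<And>x. (\<kappa> has_derivative blinfun_apply (\<kappa>' x)) (at x)" "continuous_on UNIV \<kappa>'"
    and Y: "continuous_on UNIV Y" and C: "compact C"
    and trans: "\<And>x. x \<in> C \<Longrightarrow> \<kappa> x = 0 \<Longrightarrow> \<kappa>' x (Y x) < 0"
  shows "\<exists>h\<^sub>1>0. \<forall>h x. 0 < h \<longrightarrow> h < h\<^sub>1 \<longrightarrow> x \<in> C \<longrightarrow> \<kappa> x < 0 \<longrightarrow> \<kappa> (x + h *\<^sub>R Y x) < 0"
proof (rule ccontr)
  assume "\<not> ?thesis"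
  then have neg: "\<exists>h x. 0 < h \<and> h < h\<^sub>1 \<and> x \<in> C \<and> \<kappa> x < 0 \<and> \<kappa> (x + h *\<^sub>R Y x) \<ge> 0"
    if "0 < h\<^sub>1" for h\<^sub>1
    using that by (meson not_less)
  have "\<exists>h x. 0 < h \<and> h < inverse (real (Suc n)) \<and> x \<in> C \<and> \<kappa> x < 0 \<and> \<kappa> (x + h *\<^sub>R Y x) \<ge> 0" for n
    by (rule neg) auto
  then obtain h x where hx: "\<And>n. 0 < h n" "\<And>n. h n < inverse (real (Suc n))" "\<And>n. x n \<in> C"
    "\<And>n. \<kappa> (x n) < 0" "\<And>n. 0 \<le> \<kappa> (x n + h n *\<^sub>R Y (x n))"
    by metis
  have h0: "h \<longlonglongrightarrow> 0"
    by (rule tendsto_sandwich[OF _ _ tendsto_const LIMSEQ_inverse_real_of_nat])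
       (use hx(1,2) in \<open>auto intro!: always_eventually less_imp_le\<close>)
  have "\<exists>s. 0 < s \<and> s < h n \<and> 0 \<le> \<kappa>' (x n + s *\<^sub>R Y (x n)) (Y (x n))" for n
  proof -
    have "((\<lambda>s. \<kappa> (x n + s *\<^sub>R Y (x n))) has_real_derivative
        \<kappa>' (x n + s *\<^sub>R Y (x n)) (Y (x n))) (at s)" for s
    proof -
      have "((\<lambda>s. x n + s *\<^sub>R Y (x n)) has_derivative (\<lambda>u. 0 + u *\<^sub>R Y (x n))) (at s)"
        by (intro has_derivative_add has_derivative_const has_derivative_scaleR_left has_derivative_ident)
      from has_derivative_compose[OF this \<kappa>(1)] show ?thesis
        unfolding has_field_derivative_def
        by (rule has_derivative_eq_rhs) (simp add: fun_eq_iff blinfun.scaleR_right)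
    qed
    from MVT2[OF hx(1)[of n] this] obtain s where s: "0 < s" "s < h n"
      "\<kappa> (x n + h n *\<^sub>R Y (x n)) - \<kappa> (x n + 0 *\<^sub>R Y (x n))
        = (h n - 0) * \<kappa>' (x n + s *\<^sub>R Y (x n)) (Y (x n))"
      by blast
    have "0 < h n * \<kappa>' (x n + s *\<^sub>R Y (x n)) (Y (x n))" using hx(4,5)[of n] s(3) by simp
    then have "0 < \<kappa>' (x n + s *\<^sub>R Y (x n)) (Y (x n))" using hx(1) zero_less_mult_pos by blast
    then show ?thesis using s(1,2) less_imp_le by blast
  qed
  then obtain s where s: "\<And>n. 0 < s n" "\<And>n. s n < h n"
    "\<And>n. 0 \<le> \<kappa>' (x n + s n *\<^sub>R Y (x n)) (Y (x n))"
    by metis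
  have s0: "s \<longlonglongrightarrow> 0"
    by (rule tendsto_sandwich[OF _ _ tendsto_const h0])
       (use s(1,2) in \<open>auto intro!: always_eventually less_imp_le\<close>)
  obtain l r where l: "l \<in> C" "strict_mono (r :: nat \<Rightarrow> nat)" "(\<lambda>n. x (r n)) \<longlonglongrightarrow> l"
    using C hx(3) unfolding compact_eq_seq_compact_metric seq_compact_def o_def by metis
  have hr: "(\<lambda>n. h (r n)) \<longlonglongrightarrow> 0" and sr: "(\<lambda>n. s (r n)) \<longlonglongrightarrow> 0"
    using LIMSEQ_subseq_LIMSEQ[OF h0 l(2)] LIMSEQ_subseq_LIMSEQ[OF s0 l(2)] by (auto simp: o_def)
  have c\<kappa>: "continuous_on UNIV \<kappa>"
    using \<kappa>(1) by (meson continuous_at_imp_continuous_on has_derivative_continuous)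
  have lim: "(\<lambda>n. g (f n)) \<longlonglongrightarrow> g a" if "continuous_on UNIV g" "f \<longlonglongrightarrow> a"
    for g :: "'a \<Rightarrow> 'b::topological_space" and f a
    by (rule continuous_on_tendsto_compose[OF that]) auto
  have Yl: "(\<lambda>n. Y (x (r n))) \<longlonglongrightarrow> Y l" by (rule lim[OF Y l(3)])
  have small: "(\<lambda>n. x (r n) + c n *\<^sub>R Y (x (r n))) \<longlonglongrightarrow> l" if "c \<longlonglongrightarrow> 0" for c
    using tendsto_add[OF l(3) tendsto_scaleR[OF that Yl]] by simp
  have "\<kappa> l \<le> 0"
    by (rule tendsto_upperbound[OF lim[OF c\<kappa> l(3)]]) (simp_all add: less_imp_le[OF hx(4)])
  moreover have "\<kappa> l \<ge> 0"
    by (rule tendsto_lowerbound[OF lim[OF c\<kappa> small[OF hr]]]) (use hx(5) in auto)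
  moreover have "\<kappa>' l (Y l) \<ge> 0"
    by (rule tendsto_lowerbound[OF blinfun.tendsto[OF lim[OF \<kappa>(2) small[OF sr]] Yl]]) (use s(3) in auto)
  ultimately show False using trans[OF l(1)] by simp
qed

lemma condition_B_engulf:
  fixes E :: "'a::euclidean_space set"
  assumes cond: "condition_B E" and L: "compact L" "L \<subseteq> E" and B: "compact B"
  shows "\<exists>g. C1_diffeomorphism UNIV UNIV g \<and> (\<forall>x\<in>L. g x = x) \<and> B \<subseteq> g ` E"
proof -
  obtain \<kappa> :: "'a \<Rightarrow> real" and X K\<^sub>0 where \<kappa>: "C1_on UNIV \<kappa>" and X: "C1_on UNIV X" "bounded (range X)"
    and K0: "K\<^sub>0 \<subseteq> E" and E: "E = {z. \<kappa> z < 0}" and attr: "globally_attractive X K\<^sub>0"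
    and trans: "\<And>z. \<kappa> z = 0 \<Longrightarrow> frechet_derivative \<kappa> (at z) (X z) < 0"
    using cond unfolding condition_B_def by blast
  obtain \<kappa>' where \<kappa>': "\<And>x. (\<kappa> has_derivative blinfun_apply (\<kappa>' x)) (at x)" "continuous_on UNIV \<kappa>'"
    using \<kappa> C1_onE by (metis UNIV_I)
  have c\<kappa>: "continuous_on UNIV \<kappa>" and cX: "continuous_on UNIV X"
    using \<kappa> X C1_on_imp_continuous_on by auto
  have oE: "open E" unfolding E using c\<kappa> by (intro open_Collect_less) auto
  obtain M where M: "M > 0" "\<And>x. norm (X x) \<le> M"
    using X(2) by (auto simp: bounded_pos)
  \<comment> \<open>The margin leaves room for a cutoff between \<open>L\<close> and the complement
    of \<open>E\<close>.\<close>
  obtain a where a: "a > 0" "\<And>x. x \<in> L \<Longrightarrow> \<kappa> x \<le> - 2 * a"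
  proof (cases "L = {}")
    case False
    then obtain x0 where "x0 \<in> L" "\<And>x. x \<in> L \<Longrightarrow> \<kappa> x \<le> \<kappa> x0"
      using continuous_attains_sup[OF L(1) False] c\<kappa> continuous_on_subset by (metis top_greatest)
    then show ?thesis using L(2) E by (intro that[of "- \<kappa> x0 / 2"]) auto
  qed (use that[of 1] in simp)
  obtain R where R: "R > 0" "\<And>x. x \<in> B \<Longrightarrow> norm x \<le> R"
    using compact_imp_bounded[OF B] bounded_pos by metis
  obtain T h0 where T: "0 < T" "0 < h0" and enter: "\<And>h z. 0 < h \<Longrightarrow> h < h0 \<Longrightarrow> z \<in> B \<Longrightarrow>
      \<exists>k. real k * h \<le> T \<and> ((\<lambda>x. x + h *\<^sub>R X x) ^^ k) z \<in> E"
    using euler_iterates_enter[OF cX M(2) attr oE K0 compact_imp_bounded[OF B]] by blast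
  \<comment> \<open>Euler points that start in \<open>B\<close> with speed at most \<open>M\<close>
    stay within this radius up to time \<open>T\<close>.\<close>
  define \<rho> where "\<rho> = R + M * T"
  have \<rho>: "0 \<le> \<rho>" using R M T by (simp add: \<rho>_def)
  obtain \<theta> :: "'a \<Rightarrow> real" where \<theta>: "C1_on UNIV \<theta>" "\<And>x. 0 \<le> \<theta> x" "\<And>x. \<theta> x \<le> 1"
    "\<And>x. norm x \<le> \<rho> \<Longrightarrow> \<theta> x = 1" "\<And>x. \<rho> + 1 \<le> norm x \<Longrightarrow> \<theta> x = 0"
    by (rule C1_radial_cutoff[of \<rho> "\<rho> + 1", where 'a='a]) (use \<rho> in auto)
  \<comment> \<open>\<open>\<eta>\<close> is 0 where \<kappa> \<le> -2a, hence on \<open>L\<close>,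
    and 1 where \<kappa> \<ge> -a, hence outside \<open>E\<close>. The field \<open>Y\<close> below
    therefore vanishes on \<open>L\<close> and equals \<open>X\<close> outside \<open>E\<close>
    within radius \<open>\<rho>\<close>.\<close>
  define \<eta> where "\<eta> = (\<lambda>x. smoothstep (2 + (1/a) *\<^sub>R \<kappa> x))"
  have \<eta>: "C1_on UNIV \<eta>" unfolding \<eta>_def
    by (rule C1_on_compose[where V=UNIV, OF C1_on_add[OF C1_on_const C1_on_scaleR[OF C1_on_const \<kappa>]]
          C1_on_smoothstep]) simp
  have \<eta>01: "0 \<le> \<eta> x" "\<eta> x \<le> 1" for x by (auto simp: \<eta>_def smoothstep_bounds)
  have \<eta>1: "\<eta> x = 1" if "0 \<le> \<kappa> x" for x
    unfolding \<eta>_def using that a(1) by (intro smoothstep_eq_1) simp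
  have \<eta>0: "\<eta> x = 0" if "x \<in> L" for x
    unfolding \<eta>_def using a(2)[OF that] a(1) by (intro smoothstep_eq_0) (simp add: field_simps)
  define Y where "Y = (\<lambda>x. \<theta> x *\<^sub>R (\<eta> x *\<^sub>R X x))"
  have Y: "C1_on UNIV Y" unfolding Y_def by (intro C1_on_scaleR \<theta> \<eta> X)
  have YM: "norm (Y x) \<le> M" for x
  proof -
    have "\<theta> x * (\<eta> x * norm (X x)) \<le> 1 * (1 * M)"
      using \<theta> \<eta>01 M by (intro mult_mono) auto
    then show ?thesis using \<theta>(2) \<eta>01 by (simp add: Y_def)
  qed
  have YX: "Y x = X x" if "norm x \<le> \<rho>" "0 \<le> \<kappa> x" for x
    using \<theta>(4)[OF that(1)] \<eta>1[OF that(2)] by (simp add: Y_def)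
  obtain \<delta> where \<delta>: "\<delta> > 0"
    "\<And>h. 0 \<le> h \<Longrightarrow> h < \<delta> \<Longrightarrow> C1_diffeomorphism UNIV UNIV (\<lambda>x. x + h *\<^sub>R Y x)"
    by (rule C1_diffeomorphism_euler_step[OF Y, of "\<rho> + 1"]) (simp_all add: Y_def \<theta>(5))
  have "\<exists>h1>0. \<forall>h x. 0 < h \<longrightarrow> h < h1 \<longrightarrow> x \<in> cball 0 \<rho> \<longrightarrow> \<kappa> x < 0 \<longrightarrow> \<kappa> (x + h *\<^sub>R Y x) < 0"
  proof (rule euler_step_preserves_sublevel[OF \<kappa>' C1_on_imp_continuous_on[OF Y] compact_cball])
    fix x assume x: "x \<in> cball 0 \<rho>" "\<kappa> x = 0"
    then have "Y x = X x" by (intro YX) auto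
    then show "\<kappa>' x (Y x) < 0"
      using trans[OF x(2)] frechet_derivative_at[OF \<kappa>'(1)] by metis
  qed
  then obtain h1 where h1: "0 < h1"
    "\<And>h x. 0 < h \<Longrightarrow> h < h1 \<Longrightarrow> x \<in> cball 0 \<rho> \<Longrightarrow> \<kappa> x < 0 \<Longrightarrow> \<kappa> (x + h *\<^sub>R Y x) < 0"
    by blast
  define \<mu> where "\<mu> = min h0 (min \<delta> h1)"
  have \<mu>: "\<mu> > 0" using T \<delta> h1 by (simp add: \<mu>_def)
  obtain N where N: "T / \<mu> < real N" using reals_Archimedean2 by blast
  have N0: "N > 0" using N T \<mu> by (metis divide_pos_pos less_asym of_nat_0 gr0I)
  \<comment> \<open>\<open>N\<close> steps last exactly for time \<open>T\<close>, so an entry time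
    up to \<open>T\<close> has index at most \<open>N\<close>.\<close>
  define h where "h = T / real N"
  have h: "0 < h" "h < \<mu>" "real N * h = T"
    using N N0 T \<mu> by (auto simp: h_def field_simps)
  define G where "G = (\<lambda>x. x + h *\<^sub>R Y x)"
  have G: "C1_diffeomorphism UNIV UNIV (G ^^ N)"
    unfolding G_def using h \<delta>(2) by (intro C1_diffeomorphism_funpow) (auto simp: \<mu>_def)
  have GE: "(G ^^ N) z \<in> E" if z: "z \<in> B" for z
  proof -
    have bd: "norm ((G ^^ k) z) \<le> \<rho>" if "k \<le> N" for k
    proof -
      have "norm ((G ^^ k) z - z) \<le> M * (h * real k)"
        using euler_iterate_dist[of Y M h k z 0] YM h by (simp add: G_def)
      also have "\<dots> \<le> M * (h * real N)"
        using that h M by (intro mult_left_mono) auto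
      finally show ?thesis
        using R(2)[OF z] norm_triangle_ineq2[of "(G ^^ k) z" z] h(3)
        by (simp add: \<rho>_def mult.commute)
    qed
    have "\<exists>k\<le>N. (G ^^ k) z \<in> E"
    proof (rule ccontr)
      assume no: "\<not> ?thesis"
      \<comment> \<open>While the iterates avoid \<open>E\<close>, the fields \<open>Y\<close> and
        \<open>X\<close> agree along them and the two polygons coincide.\<close>
      have eq: "k \<le> N \<Longrightarrow> (G ^^ k) z = ((\<lambda>x. x + h *\<^sub>R X x) ^^ k) z" for k
      proof (induction k)
        case (Suc k)
        from Suc.prems have "Y ((G ^^ k) z) = X ((G ^^ k) z)"
          using no bd[of k] by (intro YX) (simp_all add: E not_less del: funpow.simps)
        then show ?case using Suc by (simp add: G_def)
      qed simp
      obtain k where k: "real k * h \<le> T" "((\<lambda>x. x + h *\<^sub>R X x) ^^ k) z \<in> E"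
        using enter[OF h(1) _ z] h(2) by (auto simp: \<mu>_def)
      then have "k \<le> N" using h by (metis mult_le_cancel_right not_less of_nat_le_iff)
      then show False using no eq k(2) by auto
    qed
    then obtain k where k: "k \<le> N" "(G ^^ k) z \<in> E" by blast
    \<comment> \<open>From the entry index on, small steps within radius \<open>\<rho>\<close>
      cannot leave the sublevel set \<open>E\<close>.\<close>
    from k(1) show ?thesis
    proof (induction N rule: dec_induct)
      case (step n)
      then have "\<kappa> (G ((G ^^ n) z)) < 0"
        unfolding G_def[THEN fun_cong] using h bd[of n] E
        by (intro h1(2)) (auto simp: \<mu>_def G_def)
      then show ?case by (simp add: E)
    qed (rule k(2))
  qed
  have GL: "(G ^^ N) x = x" if "x \<in> L" for x
    using \<eta>0[OF that] by (induction N) (auto simp: G_def Y_def)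
  have bij: "bij (G ^^ N)" using G by (simp add: C1_diffeomorphism_def)
  \<comment> \<open>\<open>G ^^ N\<close> pushes \<open>B\<close> into \<open>E\<close>, so its
    inverse expands \<open>E\<close> over \<open>B\<close>.\<close>
  have "inv (G ^^ N) x = x" if "x \<in> L" for x
    using GL[OF that] bij by (metis bij_inv_eq_iff)
  moreover have "z \<in> inv (G ^^ N) ` E" if "z \<in> B" for z
    using GE[OF that] bij by (metis bij_inv_eq_iff imageI)
  ultimately show ?thesis
    using C1_diffeomorphism_inv[OF G] by blast
qed

section \<open>Combination of the two cases\<close>

theorem theorem3p3:
  fixes O\<^sub>a :: "(real ^ 'm) set"
    and \<tau>\<^sub>a :: "real ^ 'm \<Rightarrow> real ^ 'm"
    and K :: "(real ^ 'm) set"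
  assumes "open O\<^sub>a"
    and "C1_diffeomorphism O\<^sub>a (\<tau>\<^sub>a ` O\<^sub>a) \<tau>\<^sub>a"
    and "condition_B (\<tau>\<^sub>a ` O\<^sub>a) \<or>
         ((\<exists>\<phi> :: real ^ 'm \<Rightarrow> real ^ 'm. C2_diffeomorphism O\<^sub>a UNIV \<phi>) \<and> C2_on O\<^sub>a \<tau>\<^sub>a)"
    and "compact K" and "K \<subseteq> O\<^sub>a"
  shows "\<exists>\<tau>\<^sub>e :: real ^ 'm \<Rightarrow> real ^ 'm.
           C1_diffeomorphism O\<^sub>a (\<tau>\<^sub>e ` O\<^sub>a) \<tau>\<^sub>e \<and>
           \<tau>\<^sub>e ` O\<^sub>a = UNIV \<and>
           (\<forall>z\<in>K. \<tau>\<^sub>e z = \<tau>\<^sub>a z)"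
proof -
  have image_K: "compact (f ` K)" if "C1_diffeomorphism O\<^sub>a V f" for V and f :: "real ^ 'm \<Rightarrow> real ^ 'm"
    using that assms(4,5)
    by (intro compact_continuous_image)
       (auto simp: C1_diffeomorphism_def intro: continuous_on_subset C1_on_imp_continuous_on)
  have "\<exists>\<tau>\<^sub>e. C1_diffeomorphism O\<^sub>a UNIV \<tau>\<^sub>e \<and> (\<forall>z\<in>K. \<tau>\<^sub>e z = \<tau>\<^sub>a z)"
    using assms(3)
  proof
    assume B: "condition_B (\<tau>\<^sub>a ` O\<^sub>a)"
    have "open (\<tau>\<^sub>a ` O\<^sub>a)" using assms(2) by (simp add: C1_diffeomorphism_def)
    \<comment> \<open>\<open>F\<close> is the identity on the image of \<open>K\<close>, so F o
      \<open>\<tau>\<^sub>a\<close> keeps the values of \<open>\<tau>\<^sub>a\<close> on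
      \<open>K\<close>.\<close>
    then obtain F where F: "C1_diffeomorphism (\<tau>\<^sub>a ` O\<^sub>a) UNIV F" "\<And>x. x \<in> \<tau>\<^sub>a ` K \<Longrightarrow> F x = x"
      using C1_diffeomorphism_engulfing[OF _ image_K[OF assms(2)] image_mono[OF assms(5)]
          condition_B_engulf[OF B]] by blast
    then show ?thesis
      using C1_diffeomorphism_compose[OF assms(2) F(1)] by auto
  next
    assume "(\<exists>\<phi> :: real ^ 'm \<Rightarrow> real ^ 'm. C2_diffeomorphism O\<^sub>a UNIV \<phi>) \<and> C2_on O\<^sub>a \<tau>\<^sub>a"
    then obtain \<phi> :: "real ^ 'm \<Rightarrow> real ^ 'm" where \<phi>: "C1_diffeomorphism O\<^sub>a UNIV \<phi>"
      using C2_diffeomorphism_imp_C1 by blast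
    \<comment> \<open>\<open>\<phi>\<close> turns \<open>\<tau>\<^sub>a\<close> into an embedding of
      the whole space; its extension from \<phi>(K), composed with \<open>\<phi>\<close>, is the
      required map.\<close>
    obtain g where g: "C1_diffeomorphism UNIV UNIV g"
      "\<And>x. x \<in> \<phi> ` K \<Longrightarrow> g x = \<tau>\<^sub>a (inv_into O\<^sub>a \<phi> x)"
      using C1_diffeomorphism_extend_from_compact[OF
          C1_diffeomorphism_compose[OF C1_diffeomorphism_inv[OF \<phi>] assms(2)] image_K[OF \<phi>]] by blast
    have "g (\<phi> z) = \<tau>\<^sub>a z" if "z \<in> K" for z
      using g(2) that \<phi> assms(5) by (auto simp: C1_diffeomorphism_def bij_betw_def)
    then show ?thesis
      using C1_diffeomorphism_compose[OF \<phi> g(1)] by blast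
  qed
  then show ?thesis
    by (metis C1_diffeomorphism_def bij_betw_def)
qed

end
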